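(* For every real $\varepsilon > 0$, there exists $r_0$ such that the following statements hold for all positive integers $r, R$ satisfying $R \ge r_0$. (i) It holds that $$\mu(r+R, r) \le (1+\varepsilon)\, R \ln \binom{r+R}{R}.$$ (ii) Suppose that $R \le \sqrt{18\, r \ln r}$. Then $$\mu(r+R, r) \le \mathrm{e}^{18 R^2/r} \cdot (1+\varepsilon)\, R \ln R.$$
   Context: An $r$-uniform hypergraph ($r$-graph) on a set $V$ is a collection of $r$-element subsets of $V$, called edges; its size is its number of edges. For positive integers $n \ge s > r$, a Turán $(n,s,r)$-system is an $r$-graph $\mathcal{H}$ on an $n$-element vertex set $V$ such that every $s$-element subset $S \subseteq V$ contains at least one edge of $\mathcal{H}$ (as a subset). Let $T(n,s,r)$ denote the minimum size of a Turán $(n,s,r)$-system. Define $$t(s,r) := \lim_{n\to\infty} \frac{T(n,s,r)}{\binom{n}{r}},$$ where the limit exists because $T(n,s,r)/\binom{n}{r}$ is non-decreasing in $n$ (and bounded above by $1$). Define $$\mu(s,r) := t(s,r)\cdot \binom{s}{r}.$$ Here $\ln$ is the natural logarithm. *)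

theory Defs
  imports "HOL-Analysis.Analysis"
begin

definition r_graph :: "nat \<Rightarrow> 'a set \<Rightarrow> 'a set set \<Rightarrow> bool" where
  "r_graph r V H \<longleftrightarrow> (\<forall>E\<in>H. E \<subseteq> V \<and> finite E \<and> card E = r)"

definition turan_system :: "nat \<Rightarrow> nat \<Rightarrow> nat \<Rightarrow> 'a set \<Rightarrow> 'a set set \<Rightarrow> bool" where
  "turan_system n s r V H \<longleftrightarrow>
     finite V \<and> card V = n \<and> r_graph r V H \<and>
     (\<forall>S. S \<subseteq> V \<and> card S = s \<longrightarrow> (\<exists>E\<in>H. E \<subseteq> S))"

(* Taking the vertices in nat loses nothing, since every finite set is in bijection with a
   finite set of natural numbers. *)
definition turan_number :: "nat \<Rightarrow> nat \<Rightarrow> nat \<Rightarrow> nat" where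
  "turan_number n s r =
     (LEAST m. \<exists>(V :: nat set) H. turan_system n s r V H \<and> card H = m)"

definition turan_density :: "nat \<Rightarrow> nat \<Rightarrow> real" where
  "turan_density s r = lim (\<lambda>n. real (turan_number n s r) / real (n choose r))"

definition turan_mu :: "nat \<Rightarrow> nat \<Rightarrow> real" where
  "turan_mu s r = turan_density s r * real (s choose r)"

lemma turan_system_finite: "turan_system n s r V H \<Longrightarrow> finite H"
  unfolding turan_system_def r_graph_def
  by (meson Pow_iff finite_Pow_iff rev_finite_subset subsetI)

lemma turan_system_complete:
  assumes "r \<le> s"
  shows "turan_system n s r {..<n} {E. E \<subseteq> {..<n} \<and> card E = r}"
proof -
  have "\<exists>E. E \<subseteq> {..<n} \<and> card E = r \<and> E \<subseteq> S"
    if "S \<subseteq> {..<n}" "card S = s" for S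
    using that assms by (metis obtain_subset_with_card_n order_trans)
  then show ?thesis
    unfolding turan_system_def r_graph_def by (auto intro: finite_subset)
qed

lemma turan_number_le:
  "turan_system n s r (V :: nat set) H \<Longrightarrow> turan_number n s r \<le> card H"
  unfolding turan_number_def by (rule Least_le) blast

lemma turan_number_attained:
  assumes "r \<le> s"
  obtains V :: "nat set" and H
  where "turan_system n s r V H" "card H = turan_number n s r"
proof -
  have "\<exists>m (V :: nat set) H. turan_system n s r V H \<and> card H = m"
    using turan_system_complete[OF assms] by blast
  from LeastI_ex[OF this] show ?thesis
    using that unfolding turan_number_def by blast
qed

lemma turan_number_le_choose:
  assumes "r \<le> s"
  shows "turan_number n s r \<le> n choose r"
  using turan_number_le[OF turan_system_complete[OF assms]] n_subsets[of "{..<n}" r]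
  by (metis card_lessThan finite_lessThan)

lemma turan_number_Suc:
  assumes "r \<le> s"
  shows "Suc n * turan_number n s r \<le> (Suc n - r) * turan_number (Suc n) s r"
proof -
  obtain V :: "nat set" and H
    where VH: "turan_system (Suc n) s r V H" and c: "card H = turan_number (Suc n) s r"
    using turan_number_attained[OF assms] .
  have fV: "finite V" and cV: "card V = Suc n" and rg: "r_graph r V H"
    and cov: "\<And>S. S \<subseteq> V \<Longrightarrow> card S = s \<Longrightarrow> \<exists>E\<in>H. E \<subseteq> S"
    using VH by (auto simp: turan_system_def)
  have fH: "finite H" by (rule turan_system_finite[OF VH])
  have del: "turan_number n s r \<le> card {E\<in>H. v \<notin> E}" if v: "v \<in> V" for v
  proof (rule turan_number_le)
    have "\<exists>E\<in>{E\<in>H. v \<notin> E}. E \<subseteq> S" if S: "S \<subseteq> V - {v}" "card S = s" for S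
      using cov[of S] S by blast
    then show "turan_system n s r (V - {v}) {E\<in>H. v \<notin> E}"
      using fV cV rg v by (auto simp: turan_system_def r_graph_def)
  qed
  have "Suc n * turan_number n s r = (\<Sum>v\<in>V. turan_number n s r)"
    using cV by simp
  also have "\<dots> \<le> (\<Sum>v\<in>V. card {E\<in>H. v \<notin> E})"
    by (rule sum_mono) (rule del)
  also have "\<dots> = (\<Sum>E\<in>H. card {v\<in>V. v \<notin> E})"
    using sum_multicount_gen[OF fV fH, of "\<lambda>v E. v \<notin> E" "\<lambda>E. card {v\<in>V. v \<notin> E}"]
    by simp
  also have "\<dots> = (\<Sum>E\<in>H. Suc n - r)"
  proof (rule sum.cong[OF refl])
    fix E assume "E \<in> H"
    then have "E \<subseteq> V" "finite E" "card E = r" using rg by (auto simp: r_graph_def)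
    moreover have "{v\<in>V. v \<notin> E} = V - E" by blast
    ultimately show "card {v\<in>V. v \<notin> E} = Suc n - r"
      using cV by (simp add: card_Diff_subset)
  qed
  finally show ?thesis using c by (simp add: mult.commute)
qed

lemma turan_ratio_mono:
  assumes "r \<le> s"
  shows "incseq (\<lambda>n. real (turan_number n s r) / real (n choose r))"
proof (rule incseq_SucI)
  fix n
  show "real (turan_number n s r) / real (n choose r)
          \<le> real (turan_number (Suc n) s r) / real (Suc n choose r)"
  proof (cases "r \<le> n")
    case True
    define a b where "a = real (turan_number n s r)" and "b = real (turan_number (Suc n) s r)"
    have pos: "real (n choose r) > 0" "real (Suc n choose r) > 0"
      using True by (simp_all add: zero_less_binomial)
    have key: "real (Suc n) * a \<le> real (Suc n - r) * b"
      using turan_number_Suc[OF assms, of n] unfolding a_def b_def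
      by (metis of_nat_le_iff of_nat_mult)
    have "(Suc n - r) * (Suc n choose r) = Suc n * (n choose r)"
      using binomial_absorb_comp[of "Suc n" r] by simp
    then have bin: "real (Suc n - r) * real (Suc n choose r) = real (Suc n) * real (n choose r)"
      by (metis of_nat_mult)
    have "real (Suc n) * (a * real (Suc n choose r))
            \<le> (real (Suc n - r) * b) * real (Suc n choose r)"
      using mult_right_mono[OF key, of "real (Suc n choose r)"] by (simp add: mult.assoc)
    also have "\<dots> = real (Suc n) * (b * real (n choose r))"
      using bin by (metis mult.assoc mult.commute)
    finally have "a * real (Suc n choose r) \<le> b * real (n choose r)"
      by (rule mult_left_le_imp_le) simp
    then show ?thesis using pos unfolding a_def b_def by (simp add: field_simps)
  qed (simp add: binomial_eq_0)
qed

lemma turan_density_LIMSEQ: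
  assumes "r \<le> s"
  shows "(\<lambda>n. real (turan_number n s r) / real (n choose r)) \<longlonglongrightarrow> turan_density s r"
proof -
  have "real (turan_number n s r) / real (n choose r) \<le> 1" for n
    using turan_number_le_choose[OF assms, of n] by (intro divide_le_eq_1[THEN iffD2]) (cases "n choose r = 0"; simp)
  then have "convergent (\<lambda>n. real (turan_number n s r) / real (n choose r))"
    using incseq_convergent[OF turan_ratio_mono[OF assms], of 1] unfolding convergent_def
    by blast
  then show ?thesis unfolding turan_density_def by (simp add: convergent_LIMSEQ_iff)
qed

end

theory Submission
  imports Defs "HOL-Real_Asymp.Real_Asymp"
begin

text \<open>
  Part (i). A random family of \<open>r\<close>-sets on \<open>N\<close> points, completed by one edge for each uncovered
  \<open>(r + R)\<close>-set, has relative size at most \<open>(1 + ln C(N - r, R)) / C(r + R, R)\<close>. Blowing up its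
  points and adding every \<open>r\<close>-set with two vertices in one class costs at most \<open>r\<^sup>2 / N\<close> in density,
  which is negligible already for \<open>N = r\<^sup>2 C(r + R, R)\<close>, and then \<open>ln C(N - r, R)\<close> is about
  \<open>R ln C(r + R, R)\<close>.

  Part (ii). Let each vertex fall into \<open>W\<close> independently with probability \<open>\<delta>\<close>, and choose a random
  family \<open>A\<close> of sets, an \<open>a\<close>-set being taken with probability \<open>\<alpha> / C(a + R, R)\<close>. An \<open>(r + R)\<close>-set
  \<open>S\<close> is usually covered by deleting \<open>R\<close> elements from \<open>S - W\<close> so as to land in \<open>A\<close>. With probability
  \<open>exp (- \<alpha>)\<close> this fails, and then one deletes \<open>R\<close> elements from \<open>S \<inter> W\<close> by means of an optimal
  Turan system on \<open>W\<close>, whose larger density costs only a factor \<open>\<delta>\<close> to the power \<open>- R\<close>. The choice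
  \<open>\<alpha> = R ln (2 / \<delta>)\<close> makes this second contribution negligible against any bound on \<open>\<mu>\<close> that is
  polynomial in \<open>R\<close>, while \<open>R ln (2 / \<delta>)\<close> is about \<open>R ln R\<close> if \<open>1 / \<delta>\<close> is slightly larger than \<open>R\<close>.
  Sets \<open>S\<close> with fewer than \<open>R\<close> elements in \<open>W\<close> need a Turan system on the complement of \<open>W\<close> and
  must be rare, which forces \<open>\<delta> \<ge> 4 R / r\<close>; the factor \<open>exp (18 R\<^sup>2 / r)\<close> then absorbs
  \<open>1 / (1 - \<delta>)\<close> to the power \<open>R\<close>.
\<close>

section \<open>Turan numbers and densities\<close>

lemma turan_system_image:
  assumes "turan_system n s r V H" "bij_betw f V W"
  shows "turan_system n s r W ((`) f ` H)"
proof -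
  have inj: "inj_on f V" and W: "W = f ` V"
    using assms(2) by (auto simp: bij_betw_def)
  have fV: "finite V" "card V = n" "r_graph r V H"
    and cov: "\<And>S. S \<subseteq> V \<Longrightarrow> card S = s \<Longrightarrow> \<exists>E\<in>H. E \<subseteq> S"
    using assms(1) by (auto simp: turan_system_def)
  have "r_graph r W ((`) f ` H)"
    using fV(3) inj W unfolding r_graph_def
    by (auto simp: card_image inj_on_subset)
  moreover have "\<exists>E\<in>(`) f ` H. E \<subseteq> S" if S: "S \<subseteq> W" "card S = s" for S
  proof -
    obtain S' where S': "S' \<subseteq> V" "S = f ` S'"
      using S(1) unfolding W by (meson subset_imageE)
    moreover have "card S' = s"
      using S(2) S' inj by (metis card_image inj_on_subset)
    ultimately obtain E where "E \<in> H" "E \<subseteq> S'" using cov[of S'] by auto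
    then show ?thesis using S'(2) by (intro bexI[of _ "f ` E"]) auto
  qed
  ultimately show ?thesis
    using fV inj W by (auto simp: turan_system_def card_image)
qed

text \<open>Transport along a bijection lifts the restriction of \<open>turan_number\<close> to
  vertices in \<open>nat\<close>, so later constructions may live on products or on arbitrary finite
  sets.\<close>

lemma turan_number_le_card:
  assumes "turan_system n s r V H"
  shows "turan_number n s r \<le> card H"
proof -
  have "finite V" "card V = n" using assms by (auto simp: turan_system_def)
  then obtain f where "bij_betw f V {..<n}"
    using finite_same_card_bij[of V "{..<n}"] by auto
  then have "turan_number n s r \<le> card ((`) f ` H)"
    using turan_number_le turan_system_image[OF assms] by blast
  also have "\<dots> \<le> card H"
    by (rule card_image_le[OF turan_system_finite[OF assms]])
  finally show ?thesis .
qed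

lemma turan_system_exists:
  assumes "r \<le> s" "finite W"
  obtains H where "turan_system (card W) s r W H" "card H \<le> turan_number (card W) s r"
proof -
  obtain V :: "nat set" and H
    where H: "turan_system (card W) s r V H" "card H = turan_number (card W) s r"
    using turan_number_attained[OF assms(1)] .
  then have "finite V" "card V = card W" by (auto simp: turan_system_def)
  then obtain f where "bij_betw f V W"
    using finite_same_card_bij assms(2) by blast
  then show ?thesis
    using that turan_system_image[OF H(1)] card_image_le[OF turan_system_finite[OF H(1)]] H(2)
    by metis
qed

text \<open>A non-decreasing sequence stays below its limit. Auxiliary Turan systems can therefore
  be charged at their limiting density, whatever the size of their vertex set.\<close>

lemma turan_number_le_density:
  assumes "r \<le> s"
  shows "real (turan_number n s r) \<le> turan_density s r * real (n choose r)"
proof (cases "r \<le> n")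
  case True
  then show ?thesis
    using incseq_le[OF turan_ratio_mono[OF assms] turan_density_LIMSEQ[OF assms], of n]
    by (simp add: pos_divide_le_eq)
next
  case False
  then show ?thesis
    using turan_number_le_choose[OF assms, of n] by (simp add: binomial_eq_0)
qed

text \<open>Since the ratio is non-decreasing, bounds at arbitrarily large \<open>n\<close> suffice;
  the blow-up only supplies multiples of a fixed \<open>N\<close>.\<close>

lemma turan_density_le:
  assumes "r \<le> s" "\<And>k. \<exists>n\<ge>k. real (turan_number n s r) \<le> c * real (n choose r)"
  shows "turan_density s r \<le> c"
proof (rule LIMSEQ_le_const2[OF turan_density_LIMSEQ[OF assms(1)]], intro exI allI impI)
  fix k :: nat
  obtain n where n: "n \<ge> max k r" "real (turan_number n s r) \<le> c * real (n choose r)"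
    using assms(2) by blast
  have "real (turan_number k s r) / real (k choose r)
          \<le> real (turan_number n s r) / real (n choose r)"
    using turan_ratio_mono[OF assms(1)] n(1) by (simp add: incseq_def)
  also have "\<dots> \<le> c"
    using n by (simp add: pos_divide_le_eq)
  finally show "real (turan_number k s r) / real (k choose r) \<le> c" .
qed

lemma turan_density_bounds:
  assumes "r \<le> s"
  shows "0 \<le> turan_density s r" "turan_density s r \<le> 1"
proof -
  show "0 \<le> turan_density s r"
    by (rule LIMSEQ_le_const[OF turan_density_LIMSEQ[OF assms]]) auto
  show "turan_density s r \<le> 1"
    using turan_number_le_choose[OF assms] by (intro turan_density_le[OF assms]) auto
qed

section \<open>Random subsets of a finite set\<close>

text \<open>The probability of the outcome \<open>X\<close> when each \<open>x\<close> in
  \<open>A\<close> is kept independently with probability \<open>p x\<close>. Expectations become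
  finite sums over \<open>Pow A\<close> against this weight.\<close>

definition subset_weight :: "('a \<Rightarrow> real) \<Rightarrow> 'a set \<Rightarrow> 'a set \<Rightarrow> real" where
  "subset_weight p A X = (\<Prod>x\<in>X. p x) * (\<Prod>x\<in>A - X. 1 - p x)"

text \<open>Expand the product of \<open>f x + g x\<close> over \<open>A\<close>: letting
  \<open>f\<close> vanish on \<open>Q - Z\<close> and \<open>g\<close> on \<open>Z\<close> kills
  every subset whose trace on \<open>Q\<close> is not \<open>Z\<close>, and the factors off
  \<open>Q\<close> are 1. With \<open>Z = {}\<close> this is the probability of avoiding a whole
  family \<open>Q\<close>.\<close>

lemma sum_subset_weight_trace:
  assumes "finite A" "Q \<subseteq> A" "Z \<subseteq> Q"
  shows "(\<Sum>X\<in>Pow A. of_bool (X \<inter> Q = Z) * subset_weight p A X)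
           = (\<Prod>x\<in>Z. p x) * (\<Prod>x\<in>Q - Z. 1 - p x)"
proof -
  define f where "f = (\<lambda>x. if x \<in> Q - Z then 0 else p x)"
  define g where "g = (\<lambda>x. if x \<in> Z then 0 else 1 - p x)"
  have fin: "finite Q" using assms(1,2) finite_subset by blast
  have "of_bool (X \<inter> Q = Z) * subset_weight p A X = prod f X * prod g (A - X)"
    if "X \<in> Pow A" for X
  proof (cases "X \<inter> Q = Z")
    case True
    then have "prod f X = prod p X" "prod g (A - X) = (\<Prod>x\<in>A - X. 1 - p x)"
      by (auto simp: f_def g_def intro!: prod.cong)
    with True show ?thesis by (simp add: subset_weight_def)
  next
    case False
    then obtain y where "y \<in> X \<inter> (Q - Z) \<or> y \<in> Z - X" using assms by blast
    then have "(y \<in> X \<and> f y = 0) \<or> (y \<in> A - X \<and> g y = 0)"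
      using assms by (auto simp: f_def g_def)
    then have "prod f X * prod g (A - X) = 0"
      using that assms(1) finite_subset by fastforce
    with False show ?thesis by simp
  qed
  then have "(\<Sum>X\<in>Pow A. of_bool (X \<inter> Q = Z) * subset_weight p A X)
               = (\<Prod>x\<in>A. f x + g x)"
    by (simp add: prod_add[OF assms(1)])
  also have "\<dots> = (\<Prod>x\<in>Q. f x + g x)"
    by (rule prod.mono_neutral_right) (use assms in \<open>auto simp: f_def g_def\<close>)
  also have "\<dots> = (\<Prod>x\<in>Z. f x + g x) * (\<Prod>x\<in>Q - Z. f x + g x)"
    using prod.subset_diff[OF assms(3) fin(1), of "\<lambda>x. f x + g x"] by (simp add: mult.commute)
  also have "(\<Prod>x\<in>Z. f x + g x) = (\<Prod>x\<in>Z. p x)"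
    by (rule prod.cong) (auto simp: f_def g_def)
  also have "(\<Prod>x\<in>Q - Z. f x + g x) = (\<Prod>x\<in>Q - Z. 1 - p x)"
    by (rule prod.cong) (auto simp: f_def g_def)
  finally show ?thesis .
qed

lemma sum_subset_weight: "finite A \<Longrightarrow> (\<Sum>X\<in>Pow A. subset_weight p A X) = 1"
  using sum_subset_weight_trace[of A "{}" "{}" p] by simp

lemma sum_subset_weight_mem:
  assumes "finite A" "x \<in> A"
  shows "(\<Sum>X\<in>Pow A. of_bool (x \<in> X) * subset_weight p A X) = p x"
proof -
  have "(X \<inter> {x} = {x}) \<longleftrightarrow> x \<in> X" for X by auto
  then show ?thesis using sum_subset_weight_trace[of A "{x}" "{x}" p] assms by simp
qed

text \<open>First-moment method in averaged form: a lower bound valid for every outcome also bounds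
  the mean, so no particular good outcome has to be selected.\<close>

lemma le_sum_subset_weight:
  assumes "finite A" "\<And>x. x \<in> A \<Longrightarrow> 0 \<le> p x \<and> p x \<le> 1" "\<And>X. X \<subseteq> A \<Longrightarrow> c \<le> F X"
  shows "c \<le> (\<Sum>X\<in>Pow A. F X * subset_weight p A X)"
proof -
  have "c = (\<Sum>X\<in>Pow A. c * subset_weight p A X)"
    using sum_subset_weight[OF assms(1), of p] by (simp add: sum_distrib_left[symmetric])
  also have "\<dots> \<le> (\<Sum>X\<in>Pow A. F X * subset_weight p A X)"
  proof (intro sum_mono mult_right_mono)
    fix X assume X: "X \<in> Pow A"
    then show "c \<le> F X" using assms(3) by simp
    show "0 \<le> subset_weight p A X"
      unfolding subset_weight_def using X assms(2)
      by (intro mult_nonneg_nonneg prod_nonneg) (auto simp: subset_iff)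
  qed
  finally show ?thesis .
qed

text \<open>The cap at 1 keeps the quotient a probability. Where it takes effect the base is 0, and
  \<open>m > 0\<close> makes the power 0.\<close>

lemma one_minus_min_power_le_exp:
  fixes \<alpha> :: real
  assumes "0 \<le> \<alpha>" "m > 0"
  shows "(1 - min 1 (\<alpha> / real m)) ^ m \<le> exp (- \<alpha>)"
proof (cases "\<alpha> \<le> real m")
  case True
  then show ?thesis
    using exp_ge_one_minus_x_over_n_power_n[of \<alpha> m] assms by (simp add: min_absorb2)
next
  case False
  then show ?thesis using assms by (simp add: min_def zero_power)
qed

section \<open>Sums over subsets of a given size\<close>

abbreviation nsubsets :: "'a set \<Rightarrow> nat \<Rightarrow> 'a set set" where
  "nsubsets V r \<equiv> {X. X \<subseteq> V \<and> card X = r}"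

lemma finite_nsubsets [simp]: "finite V \<Longrightarrow> finite (nsubsets V r)"
  by (rule finite_subset[of _ "Pow V"]) auto

text \<open>A set \<open>X\<close> is recovered from its parts outside and inside \<open>W\<close>,
  and \<open>b\<close> is the size of the inner part. The split form allows one part to be held
  fixed while a Turan system is counted on the other.\<close>

lemma sum_nsubsets_split:
  fixes f :: "'a set \<Rightarrow> 'a set \<Rightarrow> real"
  assumes "finite V" "W \<subseteq> V"
  shows "(\<Sum>X\<in>nsubsets V r. f (X - W) (X \<inter> W))
           = (\<Sum>b\<le>r. \<Sum>Y\<in>nsubsets (V - W) (r - b). \<Sum>Z\<in>nsubsets W b. f Y Z)"
proof -
  have fin: "finite W" "finite (V - W)" using assms finite_subset by auto
  have "(\<Sum>b\<le>r. \<Sum>Y\<in>nsubsets (V - W) (r - b). \<Sum>Z\<in>nsubsets W b. f Y Z)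
         = (\<Sum>b\<le>r. \<Sum>(Y, Z)\<in>nsubsets (V - W) (r - b) \<times> nsubsets W b. f Y Z)"
    by (simp add: sum.cartesian_product)
  also have "\<dots> = (\<Sum>(b, Y, Z)\<in>(SIGMA b:{..r}. nsubsets (V - W) (r - b) \<times> nsubsets W b). f Y Z)"
    using fin by (subst sum.Sigma) auto
  also have "\<dots> = (\<Sum>X\<in>nsubsets V r. f (X - W) (X \<inter> W))"
  proof (rule sum.reindex_bij_witness[where
        j = "\<lambda>(b, Y, Z). Y \<union> Z" and i = "\<lambda>X. (card (X \<inter> W), X - W, X \<inter> W)"])
    fix X assume X: "X \<in> nsubsets V r"
    then have "finite X" using assms(1) finite_subset by auto
    then have "card (X - W) + card (X \<inter> W) = r"
      using X card_Int_Diff[of X W] by simp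
    then show "(card (X \<inter> W), X - W, X \<inter> W)
        \<in> (SIGMA b:{..r}. nsubsets (V - W) (r - b) \<times> nsubsets W b)"
      using X by auto
  next
    fix a assume a: "a \<in> (SIGMA b:{..r}. nsubsets (V - W) (r - b) \<times> nsubsets W b)"
    then obtain b Y Z where a_eq: "a = (b, Y, Z)" and b: "b \<le> r"
      and Y: "Y \<subseteq> V - W" "card Y = r - b" and Z: "Z \<subseteq> W" "card Z = b" by auto
    have eqs: "(Y \<union> Z) - W = Y" "(Y \<union> Z) \<inter> W = Z" using Y Z by auto
    have "finite Y" "finite Z"
      using finite_subset[OF Y(1)] finite_subset[OF Z(1)] fin by auto
    then have "card (Y \<union> Z) = r" using Y Z b by (subst card_Un_disjoint) auto
    then show "(case a of (b, Y, Z) \<Rightarrow> Y \<union> Z) \<in> nsubsets V r" using a_eq Y Z assms(2) by auto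
    show "(\<lambda>X. (card (X \<inter> W), X - W, X \<inter> W)) (case a of (b, Y, Z) \<Rightarrow> Y \<union> Z) = a"
      using a_eq eqs Z by simp
    show "f ((case a of (b, Y, Z) \<Rightarrow> Y \<union> Z) - W) ((case a of (b, Y, Z) \<Rightarrow> Y \<union> Z) \<inter> W)
            = (case a of (b, Y, Z) \<Rightarrow> f Y Z)"
      using a_eq eqs by simp
  qed auto
  finally show ?thesis by simp
qed

lemma sum_Pow_card:
  fixes h :: "nat \<Rightarrow> real"
  assumes "finite X"
  shows "(\<Sum>Z\<in>Pow X. h (card Z)) = (\<Sum>b\<le>card X. real (card X choose b) * h b)"
proof -
  have "(\<Sum>Z\<in>Pow X. h (card Z)) = (\<Sum>b\<le>card X. \<Sum>Z\<in>{Z\<in>Pow X. card Z = b}. h (card Z))"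
    by (rule sum.group[symmetric]) (use assms in \<open>auto intro: card_mono\<close>)
  also have "\<dots> = (\<Sum>b\<le>card X. real (card X choose b) * h b)"
    using n_subsets[OF assms] by (intro sum.cong) auto
  finally show ?thesis .
qed

section \<open>Random Turan systems and their blow-ups\<close>

text \<open>Alteration: take each \<open>r\<close>-set with probability \<alpha> / C(s, r), so that
  an \<open>s\<close>-set stays uncovered with probability at most exp (- \<alpha>), and then repair
  every uncovered \<open>s\<close>-set by one further edge.\<close>

lemma turan_number_random_bound:
  assumes "r \<le> s" "s \<le> N"
  shows "real (turan_number N s r) / real (N choose r)
           \<le> (1 + ln (real (N - r choose (s - r)))) / real (s choose r)"
proof -
  define V where "V = {..<N}"
  define D where "D = real (N - r choose (s - r))"
  \<comment> \<open>Since C(N, s) C(s, r) = C(N, r) D, the bound C(N, s) exp (- \<alpha>) on the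
    expected number of repairs becomes C(N, r) / C(s, r), the source of the summand 1 in the
    conclusion.\<close>
  define \<alpha> where "\<alpha> = ln D"
  define p where "p = min 1 (\<alpha> / real (s choose r))"
  have fV: "finite V" "card V = N" by (auto simp: V_def)
  have m: "0 < s choose r" using assms(1) by (simp add: zero_less_binomial)
  have Dpos: "1 \<le> D" using assms unfolding D_def
    by (metis One_nat_def Suc_leI diff_le_mono of_nat_1 of_nat_le_iff zero_less_binomial)
  then have \<alpha>: "0 \<le> \<alpha>" by (simp add: \<alpha>_def)
  then have p01: "0 \<le> p" "p \<le> 1" by (auto simp: p_def)
  define U where "U = (\<lambda>A :: nat set set. {S\<in>nsubsets V s. nsubsets S r \<inter> A = {}})"
  have bound: "real (turan_number N s r)
        \<le> (\<Sum>E\<in>nsubsets V r. of_bool (E \<in> A)) + (\<Sum>S\<in>nsubsets V s. of_bool (nsubsets S r \<inter> A = {}))"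
    if A: "A \<subseteq> nsubsets V r" for A
  proof -
    have "\<forall>S\<in>nsubsets V s. \<exists>E. E \<subseteq> S \<and> card E = r"
      using assms(1) by (metis (mono_tags, lifting) mem_Collect_eq obtain_subset_with_card_n)
    then obtain e where e: "\<And>S. S \<in> nsubsets V s \<Longrightarrow> e S \<subseteq> S \<and> card (e S) = r"
      by metis
    have "turan_system N s r V (A \<union> e ` U A)"
      unfolding turan_system_def r_graph_def
    proof (intro conjI ballI allI impI)
      fix E assume "E \<in> A \<union> e ` U A"
      then have "E \<in> nsubsets V r"
      proof
        assume "E \<in> e ` U A"
        then obtain S where "S \<in> nsubsets V s" "E = e S" by (auto simp: U_def)
        then show ?thesis using e[of S] by blast
      qed (use A in blast)
      then show "E \<subseteq> V" "finite E" "card E = r" using fV finite_subset by auto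
    next
      fix S assume S: "S \<subseteq> V \<and> card S = s"
      show "\<exists>E\<in>A \<union> e ` U A. E \<subseteq> S"
      proof (cases "S \<in> U A")
        case True
        then have "e S \<in> A \<union> e ` U A" by simp
        moreover have "e S \<subseteq> S" using e[of S] S by simp
        ultimately show ?thesis by (rule bexI[rotated])
      next
        case False
        then show ?thesis using S by (auto simp: U_def)
      qed
    qed (use fV in auto)
    then have "turan_number N s r \<le> card (A \<union> e ` U A)" by (rule turan_number_le_card)
    also have "\<dots> \<le> card A + card (U A)"
      using card_Un_le[of A "e ` U A"] card_image_le[of "U A" e] fV by (simp add: U_def)
    finally have "real (turan_number N s r) \<le> real (card A) + real (card (U A))" by linarith
    moreover have "(\<Sum>E\<in>nsubsets V r. of_bool (E \<in> A)) = real (card A)"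
      using A fV by (simp add: sum.If_cases of_bool_def Int_absorb1 Collect_conj_eq[symmetric]
          flip: Int_def)
    moreover have "(\<Sum>S\<in>nsubsets V s. of_bool (nsubsets S r \<inter> A = {})) = real (card (U A))"
      using fV by (simp add: of_bool_def sum.If_cases U_def Int_def)
    ultimately show ?thesis by simp
  qed
  have "real (turan_number N s r) \<le> (\<Sum>A\<in>Pow (nsubsets V r).
      ((\<Sum>E\<in>nsubsets V r. of_bool (E \<in> A)) + (\<Sum>S\<in>nsubsets V s. of_bool (nsubsets S r \<inter> A = {})))
      * subset_weight (\<lambda>_. p) (nsubsets V r) A)"
    by (rule le_sum_subset_weight) (use fV p01 bound in auto)
  also have "\<dots> = (\<Sum>A\<in>Pow (nsubsets V r).
        (\<Sum>E\<in>nsubsets V r. of_bool (E \<in> A) * subset_weight (\<lambda>_. p) (nsubsets V r) A))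
      + (\<Sum>A\<in>Pow (nsubsets V r).
        (\<Sum>S\<in>nsubsets V s. of_bool (nsubsets S r \<inter> A = {}) * subset_weight (\<lambda>_. p) (nsubsets V r) A))"
    by (simp only: distrib_right sum_distrib_right sum.distrib)
  also have "(\<Sum>A\<in>Pow (nsubsets V r).
        (\<Sum>E\<in>nsubsets V r. of_bool (E \<in> A) * subset_weight (\<lambda>_. p) (nsubsets V r) A))
      = (\<Sum>E\<in>nsubsets V r. p)"
    by (subst sum.swap, intro sum.cong refl sum_subset_weight_mem) (use fV in auto)
  also have "(\<Sum>A\<in>Pow (nsubsets V r).
        (\<Sum>S\<in>nsubsets V s. of_bool (nsubsets S r \<inter> A = {}) * subset_weight (\<lambda>_. p) (nsubsets V r) A))
      = (\<Sum>S\<in>nsubsets V s. (1 - p) ^ (s choose r))"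
  proof (subst sum.swap, intro sum.cong refl)
    fix S assume S: "S \<in> nsubsets V s"
    then have "finite S" using fV finite_subset by auto
    then have "card (nsubsets S r) = s choose r" using n_subsets S by auto
    moreover have "nsubsets S r \<subseteq> nsubsets V r" using S by auto
    ultimately show "(\<Sum>A\<in>Pow (nsubsets V r).
        of_bool (nsubsets S r \<inter> A = {}) * subset_weight (\<lambda>_. p) (nsubsets V r) A)
      = (1 - p) ^ (s choose r)"
      using sum_subset_weight_trace[of "nsubsets V r" "nsubsets S r" "{}" "\<lambda>_. p"] fV
      by (simp add: Int_commute)
  qed
  also have "(\<Sum>E\<in>nsubsets V r. p) + (\<Sum>S\<in>nsubsets V s. (1 - p) ^ (s choose r))
      = real (N choose r) * p + real (N choose s) * (1 - p) ^ (s choose r)"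
    using n_subsets[OF fV(1)] fV(2) by simp
  also have "\<dots> \<le> real (N choose r) * (\<alpha> / real (s choose r)) + real (N choose s) * exp (- \<alpha>)"
    using one_minus_min_power_le_exp[OF \<alpha> m]
    by (intro add_mono mult_left_mono) (auto simp: p_def)
  also have "exp (- \<alpha>) = 1 / D"
    using Dpos by (simp add: \<alpha>_def exp_minus divide_inverse)
  also have "real (N choose s) * (1 / D) = real (N choose r) / real (s choose r)"
  proof -
    have "real (N choose s) * real (s choose r) = real (N choose r) * D"
      unfolding D_def using choose_mult[OF assms] by (metis of_nat_mult)
    then show ?thesis using Dpos m by (simp add: field_simps)
  qed
  also have "real (N choose r) * (\<alpha> / real (s choose r)) + real (N choose r) / real (s choose r)
      = real (N choose r) * ((1 + \<alpha>) / real (s choose r))"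
    by (simp add: add_divide_distrib distrib_left)
  finally show ?thesis
    using assms by (simp add: \<alpha>_def D_def divide_le_eq mult.commute)
qed

section \<open>Blow-ups\<close>

lemma choose_mult_pow_le:
  assumes "r \<le> N" "m > 0"
  shows "m ^ r * (N choose r) \<le> N * m choose r"
proof -
  have le: "r \<le> N * m" using assms by (metis le_trans mult_le_mono mult_1_right Suc_leI One_nat_def order_refl)
  have "real m ^ r * real (N choose r) = (\<Prod>i = 0..<r. real m) * (\<Prod>i = 0..<r. real (N - i) / real (r - i))"
    using binomial_altdef_of_nat[OF assms(1), where 'a = real] by simp
  also have "\<dots> = (\<Prod>i = 0..<r. real m * (real (N - i) / real (r - i)))"
    by (simp only: prod.distrib)
  also have "\<dots> \<le> (\<Prod>i = 0..<r. real (N * m - i) / real (r - i))"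
  proof (rule prod_mono)
    fix i assume "i \<in> {0..<r}"
    have "m * (N - i) = N * m - m * i" by (simp add: diff_mult_distrib2 mult.commute)
    also have "\<dots> \<le> N * m - i" using assms(2) by (intro diff_le_mono2) simp
    finally have "real m * real (N - i) \<le> real (N * m - i)"
      by (metis of_nat_le_iff of_nat_mult)
    then show "0 \<le> real m * (real (N - i) / real (r - i)) \<and>
        real m * (real (N - i) / real (r - i)) \<le> real (N * m - i) / real (r - i)"
      by (simp add: divide_right_mono)
  qed
  also have "\<dots> = real (N * m choose r)"
    using binomial_altdef_of_nat[OF le, where 'a = real] by simp
  finally show ?thesis by (metis of_nat_le_iff of_nat_mult of_nat_power)
qed

lemma card_nsubsets_containing_pair_le:
  assumes "finite V" "u \<in> V" "v \<in> V" "u \<noteq> v"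
  shows "card {X\<in>nsubsets V r. u \<in> X \<and> v \<in> X} \<le> card V - 2 choose (r - 2)"
proof -
  have "card {X\<in>nsubsets V r. u \<in> X \<and> v \<in> X} \<le> card (nsubsets (V - {u, v}) (r - 2))"
  proof (rule card_inj_on_le[where f = "\<lambda>X. X - {u, v}"])
    show "inj_on (\<lambda>X. X - {u, v}) {X\<in>nsubsets V r. u \<in> X \<and> v \<in> X}"
      by (rule inj_onI) blast
    show "(\<lambda>X. X - {u, v}) ` {X\<in>nsubsets V r. u \<in> X \<and> v \<in> X} \<subseteq> nsubsets (V - {u, v}) (r - 2)"
      using assms by (auto simp: card_Diff_subset)
  qed (use assms in auto)
  also have "\<dots> = card V - 2 choose (r - 2)"
    using n_subsets[of "V - {u, v}" "r - 2"] assms by (simp add: card_Diff_subset numeral_2_eq_2)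
  finally show ?thesis .
qed

text \<open>Counting \<open>r\<close>-sets with an ordered pair of distinct elements turns the left
  side into r (r - 1) C(n, r), and the factor is relaxed to r^2. For \<open>n < 2\<close> the
  subtraction \<open>n - 2\<close> truncates, but the left side vanishes.\<close>

lemma choose_two_le:
  assumes "2 \<le> r"
  shows "real n * (real n - 1) * real (n - 2 choose (r - 2)) \<le> real r ^ 2 * real (n choose r)"
proof (cases "n < 2")
  case True
  then have zero: "real n * (real n - 1) = 0" by (cases n) auto
  show ?thesis unfolding zero by simp
next
  case False
  then obtain k l where n: "n = Suc (Suc k)" and r: "r = Suc (Suc l)"
    using assms by (metis Suc_diff_Suc add_2_eq_Suc le_add_diff_inverse linorder_not_less)
  have "n * ((n - 1) * (n - 2 choose (r - 2))) = n * ((r - 1) * (n - 1 choose (r - 1)))"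
    using Suc_times_binomial[of l k] by (simp add: n r del: binomial_Suc_Suc)
  also have "\<dots> = (r - 1) * (r * (n choose r))"
    using Suc_times_binomial[of "Suc l" "Suc k"]
    by (simp add: n r mult.left_commute[of _ "Suc l"] del: binomial_Suc_Suc mult_Suc mult_Suc_right)
  also have "\<dots> \<le> r ^ 2 * (n choose r)"
    by (simp add: power2_eq_square)
  finally have "real (n * ((n - 1) * (n - 2 choose (r - 2)))) \<le> real (r ^ 2 * (n choose r))"
    using of_nat_le_iff by blast
  then show ?thesis using False by (simp add: of_nat_diff mult.assoc)
qed

text \<open>Replace each point of an optimal system on \<open>N\<close> points by a class of
  \<open>m\<close> vertices. An \<open>s\<close>-set with two vertices in one class contains an edge
  of \<open>H1\<close>; any other projects injectively to the \<open>N\<close> points and contains a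
  lift of an edge, which lies in \<open>H2\<close>. The resulting ratio is bounded independently of
  \<open>m\<close>.\<close>

lemma turan_density_blowup:
  assumes "2 \<le> r" "r \<le> s" "r \<le> N"
  shows "turan_density s r
           \<le> real r ^ 2 / real N + real (turan_number N s r) / real (N choose r)"
proof -
  obtain G where G: "turan_system N s r {..<N} G" "card G \<le> turan_number N s r"
    using turan_system_exists[OF assms(2), of "{..<N}"] by auto
  define c where "c = real r ^ 2 / real N + real (turan_number N s r) / real (N choose r)"
  have Nr: "0 < N choose r" "0 < N" using assms by auto
  have main: "real (turan_number (N * m) s r) \<le> c * real (N * m choose r)" if m: "m > 0" for m
  proof -
    define V where "V = {..<N} \<times> {..<m}"
    have fV: "finite V" "card V = N * m" by (auto simp: V_def)
    define H1 where "H1 = {X\<in>nsubsets V r. \<not> inj_on fst X}"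
    define H2 where "H2 = {X\<in>nsubsets V r. inj_on fst X \<and> fst ` X \<in> G}"
    have "turan_system (N * m) s r V (H1 \<union> H2)"
      unfolding turan_system_def r_graph_def
    proof (intro conjI ballI allI impI)
      fix E assume "E \<in> H1 \<union> H2"
      then show "E \<subseteq> V" "finite E" "card E = r"
        using fV finite_subset by (auto simp: H1_def H2_def)
    next
      fix S assume S: "S \<subseteq> V \<and> card S = s"
      then have fS: "finite S" using fV finite_subset by auto
      show "\<exists>E\<in>H1 \<union> H2. E \<subseteq> S"
      proof (cases "inj_on fst S")
        case True
        then have "card (fst ` S) = s" "fst ` S \<subseteq> {..<N}"
          using S by (auto simp: card_image V_def)
        then obtain E where E: "E \<in> G" "E \<subseteq> fst ` S"
          using G(1) unfolding turan_system_def by (elim conjE allE[of _ "fst ` S"]) auto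
        then obtain X where X: "X \<subseteq> S" "E = fst ` X" by (meson subset_imageE)
        then have "inj_on fst X" using True inj_on_subset by blast
        moreover have "card E = r" using E G(1) by (auto simp: turan_system_def r_graph_def)
        ultimately have "X \<in> H2" using X E S by (auto simp: H2_def card_image)
        then show ?thesis using X by blast
      next
        case False
        then obtain u v where uv: "u \<in> S" "v \<in> S" "u \<noteq> v" "fst u = fst v"
          by (auto simp: inj_on_def)
        have "\<exists>X. {u, v} \<subseteq> X \<and> X \<subseteq> S \<and> card X = r"
          using exists_subset_between[of "{u, v}" r S] uv assms S fS by auto
        then obtain X where X: "{u, v} \<subseteq> X" "X \<subseteq> S" "card X = r" by blast
        then have "\<not> inj_on fst X" using uv by (auto simp: inj_on_def)
        then have "X \<in> H1" using X S by (auto simp: H1_def)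
        then show ?thesis using X by blast
      qed
    qed (use fV in auto)
    then have "turan_number (N * m) s r \<le> card (H1 \<union> H2)" by (rule turan_number_le_card)
    then have le: "real (turan_number (N * m) s r) \<le> real (card H1) + real (card H2)"
      using card_Un_le[of H1 H2] by linarith
    \<comment> \<open>Union bound over the ordered pairs of distinct vertices in a common class,
      collected in \<open>P\<close>.\<close>
    have "real (card H1) \<le> real r ^ 2 / real N * real (N * m choose r)"
    proof -
      define P where "P = (SIGMA u:V. {v\<in>V. v \<noteq> u \<and> fst v = fst u})"
      have fP: "finite P" using fV by (auto simp: P_def)
      have "card {v\<in>V. v \<noteq> u \<and> fst v = fst u} = m - 1" if u: "u \<in> V" for u
      proof -
        have "{v\<in>V. v \<noteq> u \<and> fst v = fst u} = {fst u} \<times> ({..<m} - {snd u})"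
          using u by (auto simp: V_def)
        moreover have "snd u \<in> {..<m}" using u by (auto simp: V_def)
        ultimately show ?thesis by (simp add: card_cartesian_product_singleton)
      qed
      then have cP: "card P = N * m * (m - 1)"
        using fV by (simp add: P_def card_SigmaI)
      have "H1 \<subseteq> (\<Union>(u, v)\<in>P. {X\<in>nsubsets V r. u \<in> X \<and> v \<in> X})"
        by (fastforce simp: H1_def P_def inj_on_def)
      then have "card H1 \<le> card (\<Union>(u, v)\<in>P. {X\<in>nsubsets V r. u \<in> X \<and> v \<in> X})"
        using fV fP by (intro card_mono) auto
      also have "\<dots> \<le> (\<Sum>q\<in>P. card (case q of (u, v) \<Rightarrow> {X\<in>nsubsets V r. u \<in> X \<and> v \<in> X}))"
        by (rule card_UN_le[OF fP])
      also have "\<dots> \<le> (\<Sum>q\<in>P. N * m - 2 choose (r - 2))"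
        using card_nsubsets_containing_pair_le[OF fV(1)] fV(2)
        by (intro sum_mono) (force simp: P_def)
      also have "\<dots> = N * m * (m - 1) * (N * m - 2 choose (r - 2))" using cP by simp
      finally have h1: "real (card H1) \<le> real (N * m * (m - 1) * (N * m - 2 choose (r - 2)))"
        using of_nat_le_iff by blast
      define B where "B = real (N * m - 2 choose (r - 2))"
      have "real N * (real m - 1) \<le> real (N * m) - 1"
        using Nr(2) by (simp add: algebra_simps)
      then have "(real (N * m) * B) * (real N * (real m - 1)) \<le> (real (N * m) * B) * (real (N * m) - 1)"
        by (intro mult_left_mono) (auto simp: B_def)
      also have "\<dots> \<le> real r ^ 2 * real (N * m choose r)"
        using choose_two_le[OF assms(1), of "N * m"] by (simp add: B_def mult_ac)
      finally have "real N * (real (N * m) * (real m - 1) * B) \<le> real r ^ 2 * real (N * m choose r)"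
        by (simp add: mult_ac)
      then have "real (N * m) * (real m - 1) * B \<le> real r ^ 2 / real N * real (N * m choose r)"
        using Nr(2) by (simp add: field_simps)
      then show ?thesis using h1 m by (simp add: B_def of_nat_diff)
    qed
    moreover have "real (card H2) \<le> real (turan_number N s r) / real (N choose r) * real (N * m choose r)"
    proof -
      \<comment> \<open>A member of \<open>H2\<close> is the graph of a function on an edge of
        \<open>G\<close>, so each edge accounts for at most m^r of them.\<close>
      define pair where "pair = (\<lambda>(E, f :: nat \<Rightarrow> nat). (\<lambda>x. (x, f x)) ` E)"
      have GP: "E \<subseteq> {..<N}" "finite E" "card E = r" if "E \<in> G" for E
        using that G(1) by (auto simp: turan_system_def r_graph_def)
      have fG: "finite G" using turan_system_finite[OF G(1)] .
      have "H2 \<subseteq> pair ` (SIGMA E:G. E \<rightarrow>\<^sub>E {..<m})"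
      proof
        fix X assume X: "X \<in> H2"
        define f where "f = restrict (\<lambda>x. snd (inv_into X fst x)) (fst ` X)"
        have inj: "inj_on fst X" and XV: "X \<subseteq> V" and XG: "fst ` X \<in> G"
          using X by (auto simp: H2_def)
        have "f (fst y) = snd y" if "y \<in> X" for y
          using that inj by (simp add: f_def)
        then have "X = pair (fst ` X, f)" "f \<in> fst ` X \<rightarrow>\<^sub>E {..<m}"
          using XV by (auto simp: pair_def image_image V_def f_def)
        then show "X \<in> pair ` (SIGMA E:G. E \<rightarrow>\<^sub>E {..<m})"
          using XG by (intro image_eqI[where x = "(fst ` X, f)"]) auto
      qed
      then have "card H2 \<le> card (SIGMA E:G. E \<rightarrow>\<^sub>E {..<m})"
        using fG GP by (intro surj_card_le) (auto intro!: finite_SigmaI finite_PiE)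
      also have "\<dots> = (\<Sum>E\<in>G. m ^ r)"
        using fG GP by (subst card_SigmaI) (auto intro!: finite_PiE simp: card_PiE)
      also have "\<dots> = card G * m ^ r" by simp
      also have "\<dots> \<le> turan_number N s r * m ^ r" using G(2) by simp
      finally have "card H2 * (N choose r) \<le> turan_number N s r * (m ^ r * (N choose r))"
        by (metis mult.assoc mult_le_mono1)
      also have "\<dots> \<le> turan_number N s r * (N * m choose r)"
        using choose_mult_pow_le[OF assms(3) m] by simp
      finally have "real (card H2) * real (N choose r)
          \<le> real (turan_number N s r) * real (N * m choose r)"
        by (metis of_nat_le_iff of_nat_mult)
      then show ?thesis using Nr by (simp add: field_simps)
    qed
    ultimately show ?thesis
      using le unfolding c_def by (simp add: distrib_right)
  qed
  have "turan_density s r \<le> c"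
  proof (rule turan_density_le[OF assms(2)])
    fix k
    have "N * Suc k \<ge> k" using Nr by (metis Suc_leD Suc_leI mult_le_mono1 mult_1 One_nat_def le_trans order_refl)
    then show "\<exists>n\<ge>k. real (turan_number n s r) \<le> c * real (n choose r)"
      using main[of "Suc k"] by blast
  qed
  then show ?thesis by (simp add: c_def)
qed

lemma le_choose: "0 < k \<Longrightarrow> k < n \<Longrightarrow> n \<le> n choose k"
proof (induction n arbitrary: k)
  case (Suc n)
  then obtain j where k: "k = Suc j" by (cases k) auto
  show ?case
  proof (cases "k < n")
    case True
    have "n \<le> n choose k" using Suc True k by simp
    moreover have "0 < n choose j" using True k by (simp add: zero_less_binomial)
    ultimately have "Suc n \<le> (n choose j) + (n choose k)" by linarith
    then show ?thesis by (simp add: k)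
  next
    case False
    then have "k = n" using Suc by simp
    then show ?thesis by simp
  qed
qed simp

lemma turan_mu_le_log:
  assumes "2 \<le> r" "1 \<le> R"
  shows "turan_mu (r + R) r
           \<le> 2 + real R * ln (real ((r + R) choose R)) + 2 * real R * ln (real r)"
proof -
  define b where "b = (r + R) choose R"
  have b: "b = (r + R) choose r" unfolding b_def by (metis binomial_symmetric add_diff_cancel_left' le_add1)
  \<comment> \<open>Chosen so that the blow-up cost r^2 / N is exactly 1 / b, which adds only 1 to
    the bound on \<open>turan_mu\<close>.\<close>
  define N where "N = r ^ 2 * b"
  have "r + R \<le> b"
    unfolding b_def by (rule le_choose) (use assms in auto)
  then have bpos: "0 < b" and sN: "r + R \<le> N"
    using assms by (auto simp: N_def power2_eq_square intro: order_trans)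
  have rN: "r \<le> N" using sN by simp
  have "turan_density (r + R) r
      \<le> real r ^ 2 / real N + (1 + ln (real (N - r choose R))) / real b"
    using turan_density_blowup[OF assms(1) _ rN, of "r + R"] turan_number_random_bound[OF _ sN, of r]
    by (simp add: b)
  also have "real r ^ 2 / real N = 1 / real b"
    using assms by (simp add: N_def)
  finally have "turan_density (r + R) r * real b \<le> 2 + ln (real (N - r choose R))"
    using bpos by (simp add: field_simps)
  also have "ln (real (N - r choose R)) \<le> ln (real N ^ R)"
  proof -
    have "N - r choose R \<le> (N - r) ^ R"
      by (rule binomial_le_pow) (use sN in simp)
    also have "\<dots> \<le> N ^ R" by (rule power_mono) auto
    finally have "real (N - r choose R) \<le> real N ^ R" by (metis of_nat_le_iff of_nat_power)
    moreover have "0 < N - r choose R" using sN by (simp add: zero_less_binomial)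
    ultimately show ?thesis by (intro ln_mono) auto
  qed
  also have "ln (real N ^ R) = real R * ln (real b) + 2 * real R * ln (real r)"
    using bpos assms by (simp add: ln_realpow ln_mult N_def algebra_simps)
  finally show ?thesis by (simp add: turan_mu_def b[symmetric]) (simp add: b_def)
qed

section \<open>Random two-part systems\<close>

text \<open>The event that deleting \<open>R\<close> elements of \<open>Y\<close> never produces a
  member of \<open>A\<close>. Writing the size condition as a sum avoids truncated subtraction: if
  \<open>card Y < R\<close> the event is certain.\<close>

definition no_deletion_in :: "nat \<Rightarrow> 'a set set \<Rightarrow> 'a set \<Rightarrow> bool" where
  "no_deletion_in R A Y \<longleftrightarrow> (\<forall>Z\<in>A. Z \<subseteq> Y \<longrightarrow> card Z + R \<noteq> card Y)"

text \<open>Given an \<open>(r + R)\<close>-set \<open>S\<close> with fewer than \<open>R\<close>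
  elements in \<open>W\<close>, delete \<open>R\<close> elements outside \<open>W\<close> by means
  of a Turan system on \<open>V - W\<close>. Otherwise delete \<open>R\<close> elements outside
  \<open>W\<close> so as to land in \<open>A\<close>, if that is possible; if not, keep all of
  \<open>S - W\<close> and delete \<open>R\<close> elements of \<open>S \<inter> W\<close> by means
  of a Turan system on \<open>W\<close>.\<close>

lemma turan_number_two_part:
  fixes V :: "'a set"
  assumes "finite V" "W \<subseteq> V" "R \<le> r"
  defines "t \<equiv> (\<lambda>b. turan_density (b + R) b)"
  shows "real (turan_number (card V) (r + R) r) \<le> (\<Sum>X\<in>nsubsets V r.
      (if card (X \<inter> W) < R then t (r - card (X \<inter> W)) else of_bool (X - W \<in> A))
      + t (card (X \<inter> W)) * of_bool (no_deletion_in R A (X - W)))"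
proof -
  have fin: "finite W" "finite (V - W)" using assms(1,2) finite_subset by blast+
  have "\<exists>G. turan_system (card U) (a + R) a U G \<and> real (card G) \<le> t a * real (card U choose a)"
    if U: "finite U" for U :: "'a set" and a
  proof -
    obtain G where "turan_system (card U) (a + R) a U G" "card G \<le> turan_number (card U) (a + R) a"
      using turan_system_exists[OF le_add1 U] .
    then show ?thesis
      using turan_number_le_density[of a "a + R" "card U"] unfolding t_def
      by (meson le_add1 of_nat_le_iff order_trans)
  qed
  then obtain G where G: "\<And>U :: 'a set. \<And>a. finite U \<Longrightarrow>
      turan_system (card U) (a + R) a U (G U a) \<and> real (card (G U a)) \<le> t a * real (card U choose a)"
    by metis
  have Gsub: "E \<subseteq> U" "card E = a" "finite E" if "finite U" "E \<in> G U a" for U E a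
    using G[OF that(1), of a] that(2) by (auto simp: turan_system_def r_graph_def)
  have Gcov: "\<exists>E\<in>G U a. E \<subseteq> S" if "finite U" "S \<subseteq> U" "card S = a + R" for U S a
    using G[OF that(1), of a] that(2,3) by (auto simp: turan_system_def)
  have count: "(\<Sum>E\<in>nsubsets U a. of_bool (E \<in> G U a)) \<le> (\<Sum>E\<in>nsubsets U a. t a)"
    if "finite U" for U a
  proof -
    have "G U a \<subseteq> nsubsets U a" using Gsub[OF that] by auto
    then have "(\<Sum>E\<in>nsubsets U a. of_bool (E \<in> G U a)) = real (card (G U a))"
      using that by (simp add: of_bool_def sum.If_cases Int_absorb1 flip: Int_def)
    then show ?thesis using G[OF that, of a] n_subsets[OF that, of a] by (simp add: mult.commute)
  qed
  \<comment> \<open>The three kinds of edges, one per case of the covering argument;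
    \<open>Y\<close> is the part of an edge outside \<open>W\<close> and \<open>Z\<close> the part
    inside.\<close>
  define P1 where "P1 = (\<lambda>Y Z :: 'a set. card Z < R \<and> Y \<in> G (V - W) (card Y))"
  define P2 where "P2 = (\<lambda>Y Z :: 'a set. \<not> card Z < R \<and> Y \<in> A)"
  define P3 where "P3 = (\<lambda>Y Z :: 'a set. no_deletion_in R A Y \<and> Z \<in> G W (card Z))"
  define H where "H = {X\<in>nsubsets V r. P1 (X - W) (X \<inter> W) \<or> P2 (X - W) (X \<inter> W) \<or> P3 (X - W) (X \<inter> W)}"
  have inH: "\<exists>E\<in>H. E \<subseteq> S"
    if "Y \<subseteq> S - W" "Z \<subseteq> S \<inter> W" "card Y + card Z = r" "P1 Y Z \<or> P2 Y Z \<or> P3 Y Z" "S \<subseteq> V"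
    for Y Z S
  proof -
    have eqs: "(Y \<union> Z) - W = Y" "(Y \<union> Z) \<inter> W = Z" using that by auto
    have "Y \<subseteq> V" "Z \<subseteq> V" using that by auto
    then have "finite Y" "finite Z" using assms(1) finite_subset by blast+
    then have "card (Y \<union> Z) = r" using that by (subst card_Un_disjoint) auto
    then have "Y \<union> Z \<in> H" using that eqs by (auto simp: H_def)
    then show ?thesis using that by (intro bexI[of _ "Y \<union> Z"]) auto
  qed
  have "turan_system (card V) (r + R) r V H"
    unfolding turan_system_def r_graph_def
  proof (intro conjI ballI allI impI)
    fix E assume "E \<in> H"
    then show "E \<subseteq> V" "finite E" "card E = r"
      using assms(1) finite_subset by (auto simp: H_def)
  next
    fix S assume S: "S \<subseteq> V \<and> card S = r + R"
    then have "finite S" using assms(1) finite_subset by auto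
    then have sum: "card (S - W) + card (S \<inter> W) = r + R"
      using S card_Int_Diff[of S W] by simp
    consider "card (S \<inter> W) < R"
      | "\<not> card (S \<inter> W) < R" "\<not> no_deletion_in R A (S - W)"
      | "\<not> card (S \<inter> W) < R" "no_deletion_in R A (S - W)" by blast
    then show "\<exists>E\<in>H. E \<subseteq> S"
    proof cases
      case 1
      then have "card (S - W) = (r - card (S \<inter> W)) + R" using sum assms(3) by simp
      then obtain Y where Y: "Y \<in> G (V - W) (r - card (S \<inter> W))" "Y \<subseteq> S - W"
        using Gcov[OF fin(2), of "S - W"] S by (metis Diff_mono order_refl)
      then show ?thesis
        using inH[of Y S "S \<inter> W"] Gsub[OF fin(2) Y(1)] 1 assms(3) S by (auto simp: P1_def)
    next
      case 2
      then obtain Z where Z: "Z \<in> A" "Z \<subseteq> S - W" "card Z + R = card (S - W)"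
        by (auto simp: no_deletion_in_def)
      then show ?thesis
        using inH[of Z S "S \<inter> W"] 2 S sum by (auto simp: P2_def)
    next
      case 3
      then have "card (S \<inter> W) = (card (S \<inter> W) - R) + R" by simp
      then obtain Z where Z: "Z \<in> G W (card (S \<inter> W) - R)" "Z \<subseteq> S \<inter> W"
        using Gcov[OF fin(1), of "S \<inter> W"] by (metis Int_lower2)
      then show ?thesis
        using inH[of "S - W" S Z] Gsub[OF fin(1) Z(1)] 3 S sum by (auto simp: P3_def)
    qed
  qed (use assms in auto)
  then have "real (turan_number (card V) (r + R) r) \<le> real (card H)"
    using turan_number_le_card of_nat_le_iff by blast
  also have "\<dots> = (\<Sum>X\<in>nsubsets V r. of_bool (P1 (X - W) (X \<inter> W) \<or> P2 (X - W) (X \<inter> W) \<or> P3 (X - W) (X \<inter> W)))"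
    using assms(1) by (simp add: of_bool_def sum.If_cases H_def Int_def)
  also have "\<dots> \<le> (\<Sum>X\<in>nsubsets V r. of_bool (P1 (X - W) (X \<inter> W)) + of_bool (P2 (X - W) (X \<inter> W))
      + of_bool (P3 (X - W) (X \<inter> W)))"
    by (rule sum_mono) auto
  also have "\<dots> = (\<Sum>b\<le>r. \<Sum>Y\<in>nsubsets (V - W) (r - b). \<Sum>Z\<in>nsubsets W b. of_bool (P1 Y Z))
      + (\<Sum>X\<in>nsubsets V r. of_bool (P2 (X - W) (X \<inter> W)))
      + (\<Sum>b\<le>r. \<Sum>Y\<in>nsubsets (V - W) (r - b). \<Sum>Z\<in>nsubsets W b. of_bool (P3 Y Z))"
    using sum_nsubsets_split[OF assms(1,2), of "\<lambda>Y Z. of_bool (P1 Y Z)" r]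
      sum_nsubsets_split[OF assms(1,2), of "\<lambda>Y Z. of_bool (P3 Y Z)" r]
    by (simp add: sum.distrib)
  also have "(\<Sum>b\<le>r. \<Sum>Y\<in>nsubsets (V - W) (r - b). \<Sum>Z\<in>nsubsets W b. of_bool (P1 Y Z))
      \<le> (\<Sum>b\<le>r. \<Sum>Y\<in>nsubsets (V - W) (r - b). \<Sum>Z\<in>nsubsets W b. if card Z < R then t (r - card Z) else 0)"
  proof (rule sum_mono)
    fix b
    show "(\<Sum>Y\<in>nsubsets (V - W) (r - b). \<Sum>Z\<in>nsubsets W b. of_bool (P1 Y Z))
      \<le> (\<Sum>Y\<in>nsubsets (V - W) (r - b). \<Sum>Z\<in>nsubsets W b. if card Z < R then t (r - card Z) else 0)"
    proof (cases "b < R")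
      case True
      \<comment> \<open>For fixed \<open>Z\<close> the admissible \<open>Y\<close> form a Turan
        system on \<open>V - W\<close>, whose share of all sets of its size is at most the limiting
        density.\<close>
      have "(\<Sum>Y\<in>nsubsets (V - W) (r - b). \<Sum>Z\<in>nsubsets W b. of_bool (P1 Y Z))
          = (\<Sum>Z\<in>nsubsets W b. \<Sum>Y\<in>nsubsets (V - W) (r - b). of_bool (Y \<in> G (V - W) (r - b)))"
        using True by (subst sum.swap) (simp add: P1_def)
      also have "\<dots> \<le> (\<Sum>Z\<in>nsubsets W b. \<Sum>Y\<in>nsubsets (V - W) (r - b). t (r - b))"
        by (intro sum_mono count[OF fin(2)])
      also have "\<dots> = (\<Sum>Y\<in>nsubsets (V - W) (r - b). \<Sum>Z\<in>nsubsets W b. t (r - b))"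
        by (rule sum.swap)
      also have "\<dots> = (\<Sum>Y\<in>nsubsets (V - W) (r - b). \<Sum>Z\<in>nsubsets W b. if card Z < R then t (r - card Z) else 0)"
        using True by (intro sum.cong refl) auto
      finally show ?thesis .
    next
      case False
      then show ?thesis by (intro sum_mono) (auto simp: P1_def)
    qed
  qed
  also have "(\<Sum>b\<le>r. \<Sum>Y\<in>nsubsets (V - W) (r - b). \<Sum>Z\<in>nsubsets W b. of_bool (P3 Y Z))
      \<le> (\<Sum>b\<le>r. \<Sum>Y\<in>nsubsets (V - W) (r - b). \<Sum>Z\<in>nsubsets W b. t (card Z) * of_bool (no_deletion_in R A Y))"
  proof (rule sum_mono, rule sum_mono)
    fix b Y
    have "(\<Sum>Z\<in>nsubsets W b. of_bool (P3 Y Z))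
        = (\<Sum>Z\<in>nsubsets W b. of_bool (Z \<in> G W b) :: real) * of_bool (no_deletion_in R A Y)"
      unfolding sum_distrib_right by (intro sum.cong) (auto simp: P3_def)
    also have "\<dots> \<le> (\<Sum>Z\<in>nsubsets W b. t b) * of_bool (no_deletion_in R A Y)"
      by (intro mult_right_mono count[OF fin(1)]) simp
    finally show "(\<Sum>Z\<in>nsubsets W b. of_bool (P3 Y Z))
        \<le> (\<Sum>Z\<in>nsubsets W b. t (card Z) * of_bool (no_deletion_in R A Y))"
      unfolding sum_distrib_right by simp
  qed
  also have "(\<Sum>b\<le>r. \<Sum>Y\<in>nsubsets (V - W) (r - b). \<Sum>Z\<in>nsubsets W b. if card Z < R then t (r - card Z) else 0)
      = (\<Sum>X\<in>nsubsets V r. if card (X \<inter> W) < R then t (r - card (X \<inter> W)) else 0)"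
    by (rule sum_nsubsets_split[OF assms(1,2), symmetric])
  also have "(\<Sum>b\<le>r. \<Sum>Y\<in>nsubsets (V - W) (r - b). \<Sum>Z\<in>nsubsets W b. t (card Z) * of_bool (no_deletion_in R A Y))
      = (\<Sum>X\<in>nsubsets V r. t (card (X \<inter> W)) * of_bool (no_deletion_in R A (X - W)))"
    by (rule sum_nsubsets_split[OF assms(1,2), symmetric])
  finally have "real (turan_number (card V) (r + R) r)
      \<le> (\<Sum>X\<in>nsubsets V r. if card (X \<inter> W) < R then t (r - card (X \<inter> W)) else 0)
      + (\<Sum>X\<in>nsubsets V r. of_bool (P2 (X - W) (X \<inter> W)))
      + (\<Sum>X\<in>nsubsets V r. t (card (X \<inter> W)) * of_bool (no_deletion_in R A (X - W)))"
    by simp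
  also have "\<dots> = (\<Sum>X\<in>nsubsets V r.
      (if card (X \<inter> W) < R then t (r - card (X \<inter> W)) else of_bool (X - W \<in> A))
      + t (card (X \<inter> W)) * of_bool (no_deletion_in R A (X - W)))"
    unfolding sum.distrib[symmetric] by (intro sum.cong refl) (auto simp: P2_def)
  finally show ?thesis .
qed

text \<open>A set \<open>Y\<close> of size \<open>y\<close> has C(y, R) deletions of
  \<open>R\<close> elements, each in \<open>A\<close> with probability \<alpha> / C(y, R) capped at
  1. All of them miss \<open>A\<close> with probability at most exp (- \<alpha>); if
  \<open>y < R\<close> there are none, which explains the value 1.\<close>

lemma turan_number_random_two_part:
  fixes V :: "'a set"
  assumes "finite V" "W \<subseteq> V" "R \<le> r" "0 \<le> \<alpha>"
  defines "t \<equiv> (\<lambda>b. turan_density (b + R) b)"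
  shows "real (turan_number (card V) (r + R) r) \<le> (\<Sum>X\<in>nsubsets V r.
      (if card (X \<inter> W) < R then t (r - card (X \<inter> W))
       else \<alpha> / real ((r - card (X \<inter> W)) + R choose R))
      + t (card (X \<inter> W)) * (if r - card (X \<inter> W) < R then 1 else exp (- \<alpha>)))"
proof -
  define p where "p = (\<lambda>Y :: 'a set. min 1 (\<alpha> / real (card Y + R choose R)))"
  define w where "w = subset_weight p (Pow V)"
  define F where "F = (\<lambda>A X. (if card (X \<inter> W) < R then t (r - card (X \<inter> W)) else of_bool (X - W \<in> A))
      + t (card (X \<inter> W)) * of_bool (no_deletion_in R A (X - W)))"
  have fPV: "finite (Pow V)" using assms(1) by simp
  have t0: "0 \<le> t b" for b unfolding t_def by (rule turan_density_bounds) simp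
  have p01: "0 \<le> p Y \<and> p Y \<le> 1" for Y using assms(4) by (auto simp: p_def)
  have "real (turan_number (card V) (r + R) r) \<le> (\<Sum>A\<in>Pow (Pow V). (\<Sum>X\<in>nsubsets V r. F A X) * w A)"
    unfolding w_def
    by (rule le_sum_subset_weight[OF fPV p01])
      (unfold F_def t_def, rule turan_number_two_part[OF assms(1-3)])
  also have "\<dots> = (\<Sum>X\<in>nsubsets V r. \<Sum>A\<in>Pow (Pow V). F A X * w A)"
    by (simp only: sum_distrib_right sum.swap[of _ "Pow (Pow V)"])
  also have "\<dots> \<le> (\<Sum>X\<in>nsubsets V r.
      (if card (X \<inter> W) < R then t (r - card (X \<inter> W))
       else \<alpha> / real ((r - card (X \<inter> W)) + R choose R))
      + t (card (X \<inter> W)) * (if r - card (X \<inter> W) < R then 1 else exp (- \<alpha>)))"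
  proof (rule sum_mono)
    fix X assume X: "X \<in> nsubsets V r"
    define Y where "Y = X - W"
    define b where "b = card (X \<inter> W)"
    have fX: "finite X" using X assms(1) finite_subset by auto
    have Y: "Y \<in> Pow V" "card Y = r - b" "finite Y"
      using X fX card_Int_Diff[OF fX, of W] by (auto simp: Y_def b_def)
    have w1: "(\<Sum>A\<in>Pow (Pow V). w A) = 1"
      unfolding w_def by (rule sum_subset_weight[OF fPV])
    have "(\<Sum>A\<in>Pow (Pow V). of_bool (Y \<in> A) * w A) = p Y"
      unfolding w_def by (rule sum_subset_weight_mem[OF fPV Y(1)])
    then have first: "(\<Sum>A\<in>Pow (Pow V). (if b < R then t (r - b) else of_bool (Y \<in> A)) * w A)
        \<le> (if b < R then t (r - b) else \<alpha> / real ((r - b) + R choose R))"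
      using w1 Y(2) by (auto simp: sum_distrib_left[symmetric] p_def)
    define Q where "Q = {Z. Z \<subseteq> Y \<and> card Z + R = card Y}"
    have "no_deletion_in R A Y \<longleftrightarrow> A \<inter> Q = {}" for A
      by (auto simp: no_deletion_in_def Q_def)
    moreover have "Q \<subseteq> Pow V" using Y(1) by (auto simp: Q_def)
    ultimately have "(\<Sum>A\<in>Pow (Pow V). of_bool (no_deletion_in R A Y) * w A) = (\<Prod>Z\<in>Q. 1 - p Z)"
      using sum_subset_weight_trace[OF fPV, of Q "{}" p] by (simp add: w_def)
    also have "\<dots> \<le> (if r - b < R then 1 else exp (- \<alpha>))"
    proof (cases "r - b < R")
      case True
      then show ?thesis using p01 by (auto intro!: prod_le_1)
    next
      case False
      then have Q: "Q = nsubsets Y (r - b - R)" using Y(2) by (auto simp: Q_def)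
      have "(\<Prod>Z\<in>Q. 1 - p Z) = (\<Prod>Z\<in>Q. 1 - min 1 (\<alpha> / real (r - b choose R)))"
        using False Y(2) by (intro prod.cong refl) (auto simp: Q_def p_def)
      also have "\<dots> = (1 - min 1 (\<alpha> / real (r - b choose R))) ^ (r - b choose R)"
        using n_subsets[OF Y(3), of "r - b - R"] Y(2) False binomial_symmetric[of R "r - b"]
        by (simp add: Q)
      also have "\<dots> \<le> exp (- \<alpha>)"
        using False by (intro one_minus_min_power_le_exp assms(4)) (simp add: zero_less_binomial)
      finally show ?thesis using False by simp
    qed
    finally have second: "(\<Sum>A\<in>Pow (Pow V). (t b * of_bool (no_deletion_in R A Y)) * w A)
        \<le> t b * (if r - b < R then 1 else exp (- \<alpha>))"
      using t0[of b] by (simp add: mult.assoc sum_distrib_left[symmetric] mult_left_mono)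
    show "(\<Sum>A\<in>Pow (Pow V). F A X * w A) \<le>
      (if card (X \<inter> W) < R then t (r - card (X \<inter> W))
       else \<alpha> / real ((r - card (X \<inter> W)) + R choose R))
      + t (card (X \<inter> W)) * (if r - card (X \<inter> W) < R then 1 else exp (- \<alpha>))"
      using add_mono[OF first second]
      by (simp only: F_def Y_def b_def distrib_right sum.distrib)
  qed
  finally show ?thesis .
qed

text \<open>Now \<open>W\<close> is random too. The size of its trace on a fixed
  \<open>r\<close>-set \<open>X\<close> is binomially distributed, so every \<open>X\<close>
  contributes the same amount and the bound does not depend on the number of vertices.\<close>

lemma turan_density_random_two_part:
  fixes \<delta> \<alpha> :: real
  assumes "R \<le> r" "0 \<le> \<alpha>" "0 \<le> \<delta>" "\<delta> \<le> 1"
  defines "t \<equiv> (\<lambda>b. turan_density (b + R) b)"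
  shows "t r \<le> (\<Sum>b\<le>r. real (r choose b) * (\<delta> ^ b * (1 - \<delta>) ^ (r - b) *
      ((if b < R then t (r - b) else \<alpha> / real ((r - b) + R choose R))
       + t b * (if r - b < R then 1 else exp (- \<alpha>)))))"
    (is "_ \<le> ?B")
proof -
  define \<phi> where "\<phi> = (\<lambda>b. (if b < R then t (r - b) else \<alpha> / real ((r - b) + R choose R))
       + t b * (if r - b < R then 1 else exp (- \<alpha>)))"
  have bound: "real (turan_number n (r + R) r) \<le> ?B * real (n choose r)" for n
  proof -
    define V where "V = {..<n}"
    define w where "w = subset_weight (\<lambda>_. \<delta>) V"
    have fV: "finite V" "card V = n" by (auto simp: V_def)
    have "real (turan_number n (r + R) r)
        \<le> (\<Sum>W\<in>Pow V. (\<Sum>X\<in>nsubsets V r. \<phi> (card (X \<inter> W))) * w W)"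
      unfolding w_def
    proof (rule le_sum_subset_weight)
      fix W assume "W \<subseteq> V"
      then show "real (turan_number n (r + R) r) \<le> (\<Sum>X\<in>nsubsets V r. \<phi> (card (X \<inter> W)))"
        using turan_number_random_two_part[OF fV(1) _ assms(1,2), of W]
        unfolding \<phi>_def t_def fV(2) by simp
    qed (use fV assms in auto)
    also have "\<dots> = (\<Sum>X\<in>nsubsets V r. \<Sum>W\<in>Pow V. \<phi> (card (X \<inter> W)) * w W)"
      by (simp only: sum_distrib_right sum.swap[of _ "Pow V"])
    also have "\<dots> = (\<Sum>X\<in>nsubsets V r. ?B)"
    proof (rule sum.cong[OF refl])
      fix X assume X: "X \<in> nsubsets V r"
      then have fX: "finite X" "X \<subseteq> V" "card X = r" using fV finite_subset by auto
      \<comment> \<open>Condition on the trace \<open>Z\<close> of \<open>W\<close> on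
        \<open>X\<close>.\<close>
      have "(\<Sum>W\<in>Pow V. \<phi> (card (X \<inter> W)) * w W)
          = (\<Sum>W\<in>Pow V. \<Sum>Z\<in>Pow X. of_bool (W \<inter> X = Z) * w W * \<phi> (card Z))"
      proof (rule sum.cong[OF refl])
        fix W assume "W \<in> Pow V"
        have "(\<Sum>Z\<in>Pow X. of_bool (W \<inter> X = Z) * w W * \<phi> (card Z))
            = (\<Sum>Z\<in>Pow X. if W \<inter> X = Z then w W * \<phi> (card Z) else 0)"
          by (rule sum.cong) auto
        also have "\<dots> = w W * \<phi> (card (W \<inter> X))"
          using fX by (subst sum.delta') auto
        finally show "\<phi> (card (X \<inter> W)) * w W
            = (\<Sum>Z\<in>Pow X. of_bool (W \<inter> X = Z) * w W * \<phi> (card Z))"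
          by (simp add: Int_commute mult.commute)
      qed
      also have "\<dots> = (\<Sum>Z\<in>Pow X. (\<Sum>W\<in>Pow V. of_bool (W \<inter> X = Z) * w W) * \<phi> (card Z))"
        by (subst sum.swap) (simp only: sum_distrib_right)
      also have "\<dots> = (\<Sum>Z\<in>Pow X. \<delta> ^ card Z * (1 - \<delta>) ^ (r - card Z) * \<phi> (card Z))"
      proof (rule sum.cong[OF refl])
        fix Z assume Z: "Z \<in> Pow X"
        then have "finite Z" using fX finite_subset by auto
        then show "(\<Sum>W\<in>Pow V. of_bool (W \<inter> X = Z) * w W) * \<phi> (card Z)
            = \<delta> ^ card Z * (1 - \<delta>) ^ (r - card Z) * \<phi> (card Z)"
          using sum_subset_weight_trace[OF fV(1) fX(2), of Z "\<lambda>_. \<delta>"] Z fX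
          by (simp add: w_def card_Diff_subset)
      qed
      also have "\<dots> = ?B"
        using sum_Pow_card[OF fX(1), of "\<lambda>b. \<delta> ^ b * (1 - \<delta>) ^ (r - b) * \<phi> b"] fX(3)
        by (simp add: \<phi>_def)
      finally show "(\<Sum>W\<in>Pow V. \<phi> (card (X \<inter> W)) * w W) = ?B" .
    qed
    also have "\<dots> = ?B * real (n choose r)"
      using n_subsets[OF fV(1), of r] fV(2) by simp
    finally show ?thesis .
  qed
  have "turan_density (r + R) r \<le> ?B"
  proof (rule turan_density_le)
    fix k
    show "\<exists>n\<ge>k. real (turan_number n (r + R) r) \<le> ?B * real (n choose r)"
      using bound[of k] by blast
  qed simp
  then show ?thesis by (simp only: t_def)
qed

section \<open>The recursion for mu\<close>

lemma binomial_partial_sum_le: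
  fixes y z :: real
  assumes "0 \<le> y" "0 \<le> z"
  shows "z ^ R * (\<Sum>b\<le>r. real (r + R choose b) * (y ^ b * z ^ (r - b))) \<le> (y + z) ^ (r + R)"
proof -
  have "z ^ R * (\<Sum>b\<le>r. real (r + R choose b) * (y ^ b * z ^ (r - b)))
      = (\<Sum>b\<le>r. real (r + R choose b) * y ^ b * z ^ (r + R - b))"
    unfolding sum_distrib_left
    by (intro sum.cong refl) (simp add: power_add[symmetric] algebra_simps)
  also have "\<dots> \<le> (\<Sum>b\<le>r + R. real (r + R choose b) * y ^ b * z ^ (r + R - b))"
    by (rule sum_mono2) (use assms in auto)
  also have "\<dots> = (y + z) ^ (r + R)"
    by (simp add: binomial_ring)
  finally show ?thesis .
qed

text \<open>Multiplying by C(r + R, R) turns each bound on \<open>t\<close> into a bound on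
  \<open>turan_mu\<close> and every sum into a part of a binomial expansion with exponent
  \<open>r + R\<close>. The \<alpha> sum is the main term. The other three (few elements in
  \<open>W\<close>, no deletion into \<open>A\<close>, few elements outside \<open>W\<close>) each
  contribute at most 2^(-R) M / (1 - \<delta>)^R.\<close>

lemma turan_mu_recursion:
  fixes \<delta> M :: real
  assumes R: "1 \<le> R" and \<delta>: "0 < \<delta>" "\<delta> \<le> 1 / 8" and r: "4 * real R \<le> \<delta> * real r"
    and M: "\<And>b. b \<le> r \<Longrightarrow> turan_mu (b + R) b \<le> M"
  shows "turan_mu (r + R) r
           \<le> (real R * ln (2 / \<delta>) + 3 * (1 / 2) ^ R * M) / (1 - \<delta>) ^ R"
proof -
  \<comment> \<open>Makes exp (- \<alpha>) equal to (\<delta> / 2)^R: the power of \<delta> cancels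
    the loss from working inside \<open>W\<close>, and the power of 1 / 2 remains as gain.\<close>
  define \<alpha> where "\<alpha> = real R * ln (2 / \<delta>)"
  define t where "t = (\<lambda>b. turan_density (b + R) b)"
  define c where "c = real (r + R choose R)"
  define x where "x = (\<lambda>b. \<delta> ^ b * (1 - \<delta>) ^ (r - b))"
  have \<alpha>: "0 \<le> \<alpha>" using \<delta> by (simp add: \<alpha>_def)
  have exp\<alpha>: "exp (- \<alpha>) = (\<delta> / 2) ^ R"
    using \<delta> by (simp add: \<alpha>_def exp_minus exp_of_nat_mult power_divide)
  have "32 * real R \<le> real r"
    using r \<delta> mult_right_mono[OF \<delta>(2), of "real r"] by simp
  then have rR: "32 * R \<le> r" by linarith
  have t0: "0 \<le> t b" for b unfolding t_def by (rule turan_density_bounds) simp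
  have sym: "real (b + R choose b) = real (b + R choose R)" for b
    using binomial_symmetric[of b "b + R"] by simp
  have M0: "0 \<le> M"
    using M[of 0] t0[of 0] by (simp add: turan_mu_def t_def)
  have cpos: "0 < c" by (simp add: c_def zero_less_binomial)
  have x0: "0 \<le> x b" for b using \<delta> by (simp add: x_def)
  have tM: "t b \<le> M / real (b + R choose R)" if "b \<le> r" for b
    using M[OF that] sym[of b] by (simp add: turan_mu_def t_def pos_le_divide_eq zero_less_binomial)
  have A: "c * real (r choose b) / real (b + R choose R) = real (r + R choose (r - b))" if "b \<le> r" for b
  proof -
    have "(r + R choose (b + R)) * (b + R choose R) = (r + R choose R) * (r choose b)"
      using choose_mult[of R "b + R" "r + R"] that by simp
    moreover have "r + R choose (b + R) = r + R choose (r - b)"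
      using binomial_symmetric[of "b + R" "r + R"] that by simp
    ultimately have "c * real (r choose b) = real (r + R choose (r - b)) * real (b + R choose R)"
      unfolding c_def by (metis of_nat_mult)
    then show ?thesis by (simp add: zero_less_binomial)
  qed
  have B: "c * real (r choose b) / real ((r - b) + R choose R) = real (r + R choose b)" if "b \<le> r" for b
    using A[of "r - b"] binomial_symmetric[OF that] that by simp
  have "c * t r \<le> c * (\<Sum>b\<le>r. real (r choose b) * (\<delta> ^ b * (1 - \<delta>) ^ (r - b) *
      ((if b < R then t (r - b) else \<alpha> / real ((r - b) + R choose R))
       + t b * (if r - b < R then 1 else exp (- \<alpha>)))))"
    using turan_density_random_two_part[of R r \<alpha> \<delta>] \<alpha> \<delta> rR cpos
    unfolding t_def by (intro mult_left_mono) auto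
  also have "\<dots> \<le> (\<Sum>b\<le>r. \<alpha> * (real (r + R choose b) * x b)
      + M * (if b < R then real (r + R choose b) * x b else 0)
      + M * exp (- \<alpha>) * (real (r + R choose (r - b)) * x b)
      + M * (if r - b < R then real (r + R choose (r - b)) * x b else 0))"
    unfolding sum_distrib_left
  proof (rule sum_mono)
    fix b assume "b \<in> {..r}"
    then have b: "b \<le> r" by simp
    define K where "K = c * real (r choose b) * x b"
    have K0: "0 \<le> K" using cpos x0 by (simp add: K_def)
    have KA: "K / real (b + R choose R) = real (r + R choose (r - b)) * x b"
      using arg_cong[OF A[OF b], of "\<lambda>u. u * x b"] by (simp add: K_def)
    have KB: "K / real ((r - b) + R choose R) = real (r + R choose b) * x b"
      using arg_cong[OF B[OF b], of "\<lambda>u. u * x b"] by (simp add: K_def)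
    have "K * (if b < R then t (r - b) else \<alpha> / real ((r - b) + R choose R))
        \<le> K * (if b < R then M / real ((r - b) + R choose R) else \<alpha> / real ((r - b) + R choose R))"
      using K0 tM[of "r - b"] by (intro mult_left_mono) auto
    also have "\<dots> \<le> \<alpha> * (K / real ((r - b) + R choose R))
        + M * (if b < R then K / real ((r - b) + R choose R) else 0)"
      using K0 \<alpha> by (auto simp: mult.commute)
    finally have 1: "K * (if b < R then t (r - b) else \<alpha> / real ((r - b) + R choose R))
        \<le> \<alpha> * (real (r + R choose b) * x b) + M * (if b < R then real (r + R choose b) * x b else 0)"
      unfolding KB .
    have "K * (t b * (if r - b < R then 1 else exp (- \<alpha>)))
        \<le> K * (M / real (b + R choose R) * (if r - b < R then 1 else exp (- \<alpha>)))"
      using K0 tM[OF b] by (intro mult_left_mono mult_right_mono) auto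
    also have "\<dots> \<le> M * exp (- \<alpha>) * (K / real (b + R choose R))
        + M * (if r - b < R then K / real (b + R choose R) else 0)"
      using K0 M0 by (auto simp: mult.commute)
    finally have 2: "K * (t b * (if r - b < R then 1 else exp (- \<alpha>)))
        \<le> M * exp (- \<alpha>) * (real (r + R choose (r - b)) * x b)
        + M * (if r - b < R then real (r + R choose (r - b)) * x b else 0)"
      unfolding KA .
    have "c * (real (r choose b) * (\<delta> ^ b * (1 - \<delta>) ^ (r - b) *
      ((if b < R then t (r - b) else \<alpha> / real ((r - b) + R choose R))
       + t b * (if r - b < R then 1 else exp (- \<alpha>)))))
      = K * (if b < R then t (r - b) else \<alpha> / real ((r - b) + R choose R))
        + K * (t b * (if r - b < R then 1 else exp (- \<alpha>)))"
      by (simp only: K_def x_def distrib_left mult.assoc)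
    with 1 2 show "c * (real (r choose b) * (\<delta> ^ b * (1 - \<delta>) ^ (r - b) *
      ((if b < R then t (r - b) else \<alpha> / real ((r - b) + R choose R))
       + t b * (if r - b < R then 1 else exp (- \<alpha>)))))
      \<le> \<alpha> * (real (r + R choose b) * x b)
      + M * (if b < R then real (r + R choose b) * x b else 0)
      + M * exp (- \<alpha>) * (real (r + R choose (r - b)) * x b)
      + M * (if r - b < R then real (r + R choose (r - b)) * x b else 0)"
      by linarith
  qed
  also have "\<dots> = \<alpha> * (\<Sum>b\<le>r. real (r + R choose b) * x b)
      + M * (\<Sum>b\<le>r. if b < R then real (r + R choose b) * x b else 0)
      + M * exp (- \<alpha>) * (\<Sum>b\<le>r. real (r + R choose (r - b)) * x b)
      + M * (\<Sum>b\<le>r. if r - b < R then real (r + R choose (r - b)) * x b else 0)"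
    by (simp only: sum.distrib sum_distrib_left)
  also have "\<dots> \<le> \<alpha> * (1 / (1 - \<delta>) ^ R) + M * ((1 / 2) ^ R / (1 - \<delta>) ^ R)
      + M * ((1 / 2) ^ R / (1 - \<delta>) ^ R) + M * ((1 / 2) ^ R / (1 - \<delta>) ^ R)"
  proof (intro add_mono mult_left_mono M0 \<alpha>)
    have d: "0 < (1 - \<delta>) ^ R" using \<delta> by simp
    show "(\<Sum>b\<le>r. real (r + R choose b) * x b) \<le> 1 / (1 - \<delta>) ^ R"
      using binomial_partial_sum_le[of \<delta> "1 - \<delta>" R r] \<delta> d
      by (simp add: x_def pos_le_divide_eq mult.commute)
    \<comment> \<open>Exponential tilting: halving \<delta> inside \<delta>^b costs a factor of at
      most 2^R when \<open>b < R\<close>, while the whole expansion drops to (1 - \<delta> / 2)^(r +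
      R), at most exp (- 2 R) because \<open>4 R \<le> \<delta> r\<close>.\<close>
    show "(\<Sum>b\<le>r. if b < R then real (r + R choose b) * x b else 0) \<le> (1 / 2) ^ R / (1 - \<delta>) ^ R"
    proof -
      have "(\<Sum>b\<le>r. if b < R then real (r + R choose b) * x b else 0)
          \<le> (\<Sum>b\<le>r. 2 ^ R * (real (r + R choose b) * ((\<delta> / 2) ^ b * (1 - \<delta>) ^ (r - b))))"
      proof (rule sum_mono)
        fix b
        have p: "0 \<le> real (r + R choose b) * ((\<delta> / 2) ^ b * (1 - \<delta>) ^ (r - b))"
          using \<delta> by simp
        have "real (r + R choose b) * x b
            = 2 ^ b * (real (r + R choose b) * ((\<delta> / 2) ^ b * (1 - \<delta>) ^ (r - b)))"
          by (simp add: x_def power_divide)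
        also have "\<dots> \<le> 2 ^ R * (real (r + R choose b) * ((\<delta> / 2) ^ b * (1 - \<delta>) ^ (r - b)))"
          if "b < R"
          using that p by (intro mult_right_mono power_increasing) auto
        finally show "(if b < R then real (r + R choose b) * x b else 0)
            \<le> 2 ^ R * (real (r + R choose b) * ((\<delta> / 2) ^ b * (1 - \<delta>) ^ (r - b)))"
          using p by auto
      qed
      also have "\<dots> = 2 ^ R * (\<Sum>b\<le>r. real (r + R choose b) * ((\<delta> / 2) ^ b * (1 - \<delta>) ^ (r - b)))"
        by (simp only: sum_distrib_left)
      finally have "(1 - \<delta>) ^ R * (\<Sum>b\<le>r. if b < R then real (r + R choose b) * x b else 0)
          \<le> 2 ^ R * ((1 - \<delta>) ^ R * (\<Sum>b\<le>r. real (r + R choose b) * ((\<delta> / 2) ^ b * (1 - \<delta>) ^ (r - b))))"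
        using d by (simp add: mult.left_commute)
      also have "\<dots> \<le> 2 ^ R * (\<delta> / 2 + (1 - \<delta>)) ^ (r + R)"
        using binomial_partial_sum_le[of "\<delta> / 2" "1 - \<delta>" R r] \<delta> by (intro mult_left_mono) auto
      also have "\<dots> \<le> 2 ^ R * exp (- (\<delta> / 2)) ^ (r + R)"
        using exp_ge_add_one_self[of "- (\<delta> / 2)"] \<delta> by (intro mult_left_mono power_mono) auto
      also have "\<dots> = 2 ^ R * exp (- (real (r + R) * (\<delta> / 2)))"
        by (simp add: exp_of_nat_mult[symmetric])
      also have "\<dots> \<le> 2 ^ R * exp (- (2 * real R))"
        using r \<delta> by (intro mult_left_mono) (auto simp: algebra_simps intro: order_trans)
      also have "\<dots> = 2 ^ R * (exp (- 1) ^ 2) ^ R"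
        by (simp add: exp_of_nat_mult[symmetric] power_mult[symmetric] mult.commute)
      also have "\<dots> \<le> 2 ^ R * ((1 / 2) ^ 2) ^ R"
        using exp_ge_add_one_self[of 1] by (intro mult_left_mono power_mono) (auto simp: exp_minus field_simps)
      also have "\<dots> = (1 / 2) ^ R"
        by (simp add: power_mult_distrib[symmetric] power2_eq_square)
      finally show ?thesis using d by (simp add: pos_le_divide_eq mult.commute)
    qed
    have rev: "(\<Sum>b\<le>r. g (r - b)) = (\<Sum>b\<le>r. g b)" for g :: "nat \<Rightarrow> real"
      using sum.nat_diff_reindex[of g "Suc r"] by (simp add: lessThan_Suc_atMost)
    have xr: "x b = (1 - \<delta>) ^ (r - b) * \<delta> ^ (r - (r - b))" if "b \<le> r" for b
      using that by (simp add: x_def mult.commute)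
    \<comment> \<open>Reversing the order of summation exchanges the roles of \<delta> and 1 -
      \<delta>, so the partial expansion is only bounded by \<delta>^(-R).\<close>
    show "M * exp (- \<alpha>) * (\<Sum>b\<le>r. real (r + R choose (r - b)) * x b) \<le> M * ((1 / 2) ^ R / (1 - \<delta>) ^ R)"
    proof -
      have "(\<Sum>b\<le>r. real (r + R choose (r - b)) * x b)
          = (\<Sum>b\<le>r. (\<lambda>b. real (r + R choose b) * ((1 - \<delta>) ^ b * \<delta> ^ (r - b))) (r - b))"
        using xr by (intro sum.cong) auto
      also have "\<dots> = (\<Sum>b\<le>r. real (r + R choose b) * ((1 - \<delta>) ^ b * \<delta> ^ (r - b)))"
        by (rule rev)
      finally have "\<delta> ^ R * (\<Sum>b\<le>r. real (r + R choose (r - b)) * x b) \<le> 1"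
        using binomial_partial_sum_le[of "1 - \<delta>" \<delta> R r] \<delta> by simp
      then have "(1 / 2) ^ R * (\<delta> ^ R * (\<Sum>b\<le>r. real (r + R choose (r - b)) * x b)) \<le> (1 / 2) ^ R * 1"
        by (intro mult_left_mono) auto
      also have "\<dots> \<le> (1 / 2) ^ R / (1 - \<delta>) ^ R"
        using d \<delta> by (simp add: pos_le_divide_eq power_le_one)
      finally have "M * ((1 / 2) ^ R * (\<delta> ^ R * (\<Sum>b\<le>r. real (r + R choose (r - b)) * x b)))
          \<le> M * ((1 / 2) ^ R / (1 - \<delta>) ^ R)"
        using M0 by (rule mult_left_mono)
      then show ?thesis by (simp add: exp\<alpha> power_divide mult.assoc)
    qed
    show "(\<Sum>b\<le>r. if r - b < R then real (r + R choose (r - b)) * x b else 0) \<le> (1 / 2) ^ R / (1 - \<delta>) ^ R"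
    proof -
      have "(\<Sum>b\<le>r. if r - b < R then real (r + R choose (r - b)) * x b else 0)
          = (\<Sum>b\<le>r. (\<lambda>b. if b < R then real (r + R choose b) * ((1 - \<delta>) ^ b * \<delta> ^ (r - b)) else 0) (r - b))"
        using xr by (intro sum.cong) auto
      also have "\<dots> = (\<Sum>b\<le>r. if b < R then real (r + R choose b) * ((1 - \<delta>) ^ b * \<delta> ^ (r - b)) else 0)"
        by (rule rev)
      \<comment> \<open>A crude bound is enough: \<open>W\<close> would have to contain more than
        \<open>r - R\<close> elements of the set, and 8^(r - R) outweighs the full row sum 2^(r + R)
        because \<open>r\<close> is at least \<open>32 R\<close>.\<close>
      also have "\<dots> \<le> (\<Sum>b\<le>r. real (r + R choose b) * (1 / 8) ^ (r - R))"
      proof (rule sum_mono)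
        fix b
        have "(1 - \<delta>) ^ b * \<delta> ^ (r - b) \<le> 1 * (1 / 8) ^ (r - R)" if "b < R"
        proof (rule mult_mono)
          show "(1 - \<delta>) ^ b \<le> 1" using \<delta> by (simp add: power_le_one)
          have "\<delta> ^ (r - b) \<le> \<delta> ^ (r - R)" using \<delta> that by (intro power_decreasing) auto
          also have "\<dots> \<le> (1 / 8) ^ (r - R)" using \<delta> by (intro power_mono) auto
          finally show "\<delta> ^ (r - b) \<le> (1 / 8) ^ (r - R)" .
        qed (use \<delta> in auto)
        then show "(if b < R then real (r + R choose b) * ((1 - \<delta>) ^ b * \<delta> ^ (r - b)) else 0)
            \<le> real (r + R choose b) * (1 / 8) ^ (r - R)"
          by (auto intro: mult_left_mono)
      qed
      also have "\<dots> \<le> (\<Sum>b\<le>r + R. real (r + R choose b) * (1 / 8) ^ (r - R))"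
        by (rule sum_mono2) auto
      also have "\<dots> = (\<Sum>b\<le>r + R. real (r + R choose b)) * (1 / 8) ^ (r - R)"
        by (simp only: sum_distrib_right)
      also have "(\<Sum>b\<le>r + R. real (r + R choose b)) = 2 ^ (r + R)"
        using choose_row_sum[of "r + R"] by (metis of_nat_sum of_nat_power of_nat_numeral)
      also have "2 ^ (r + R) * (1 / 8) ^ (r - R) \<le> ((1 / 2) ^ R :: real)"
      proof -
        have "r + R + R \<le> 3 * (r - R)" using rR by simp
        then have "(2 :: real) ^ (r + R + R) \<le> 2 ^ (3 * (r - R))"
          by (intro power_increasing) auto
        then have "(2 :: real) ^ (r + R) * 2 ^ R \<le> 8 ^ (r - R)"
          by (simp add: power_add power_mult)
        then show ?thesis by (simp add: power_one_over field_simps)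
      qed
      also have "(1 / 2) ^ R \<le> (1 / 2) ^ R / (1 - \<delta>) ^ R"
        using d \<delta> by (simp add: pos_le_divide_eq power_le_one)
      finally show ?thesis .
    qed
  qed
  also have "\<dots> = (\<alpha> + 3 * (1 / 2) ^ R * M) / (1 - \<delta>) ^ R"
    by (simp add: add_divide_distrib algebra_simps)
  finally show ?thesis
    using sym[of r] by (simp add: turan_mu_def t_def c_def \<alpha>_def mult.commute)
qed

section \<open>Asymptotic bounds\<close>

lemma turan_mu_le_choose: "turan_mu (r + R) r \<le> real (r + R choose r)"
  using turan_density_bounds(2)[of r "r + R"] unfolding turan_mu_def
  by (simp add: mult_left_le_one_le turan_density_bounds(1))

text \<open>An a priori bound to serve as \<open>M\<close> in the recursion, where the factor 2^(-R)
  makes any polynomial negligible. For \<open>r\<close> below \<open>R ^ 3\<close> the logarithmic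
  bound suffices, since ln C(r + R, R) is at most \<open>r + R\<close>; beyond that the recursion
  itself carries the induction on \<open>r\<close>.\<close>

lemma turan_mu_le_power5:
  assumes R: "8 \<le> R"
  shows "turan_mu (r + R) r \<le> real R ^ 5"
proof (induction r rule: less_induct)
  case (less r)
  have R8: "8 \<le> real R" using R by simp
  have R2: "64 \<le> real R ^ 2" using power_mono[OF R8, of 2] by simp
  have R4: "8 * real R ^ 4 \<le> real R ^ 5"
    using mult_right_mono[OF R8, of "real R ^ 4"] by (simp add: eval_nat_numeral)
  have R24: "64 * real R ^ 2 \<le> real R ^ 4"
    using mult_right_mono[OF R2, of "real R ^ 2"] by (simp add: eval_nat_numeral mult_ac)
  have RR: "real R \<le> real R ^ 2"
    using mult_right_mono[of 1 "real R" "real R"] R8 by (simp add: power2_eq_square)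
  consider "r \<le> 1" | "2 \<le> r" "r < R ^ 3" | "R ^ 3 \<le> r" by linarith
  then show ?case
  proof cases
    case 1
    then have "turan_mu (r + R) r \<le> 1 + real R"
      using turan_mu_le_choose[of r R] by (cases r) auto
    then show ?thesis using R8 RR R24 R4 by linarith
  next
    case 2
    have "real (r + R choose R) \<le> real (2 ^ (r + R))"
      by (simp only: of_nat_le_iff binomial_le_pow2)
    then have "ln (real (r + R choose R)) \<le> ln (2 ^ (r + R))"
      by (intro ln_mono) (simp_all add: zero_less_binomial)
    also have "\<dots> = real (r + R) * ln 2" by (rule ln_realpow)
    also have "\<dots> \<le> real (r + R) * 1"
      using ln_le_minus_one[of 2] by (intro mult_left_mono) auto
    also have "\<dots> = real (r + R)" by simp
    finally have "real R * ln (real (r + R choose R)) \<le> real R * real (r + R)"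
      by (intro mult_left_mono) auto
    moreover have "real R * ln (real r) \<le> real R * real r"
      using 2 ln_le_minus_one[of "real r"] by (intro mult_left_mono) auto
    ultimately have "turan_mu (r + R) r \<le> 2 + 3 * (real R * real r) + real R ^ 2"
      using turan_mu_le_log[OF 2(1), of R] R
      by (simp only: of_nat_add distrib_left power2_eq_square mult.assoc) linarith
    moreover have "real R * real r \<le> real R * real R ^ 3"
      using 2(2) by (intro mult_left_mono) (auto simp flip: of_nat_power)
    ultimately have "turan_mu (r + R) r \<le> 2 + 3 * real R ^ 4 + real R ^ 2"
      by (simp add: eval_nat_numeral)
    then show ?thesis using R2 R24 R4 by linarith
  next
    case 3
    \<comment> \<open>Small enough that \<open>R * \<delta> \<le> 1 / 2\<close>, so Bernoulli's
      inequality keeps (1 - \<delta>)^R above 1 / 2, and large enough that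
      \<open>R ^ 3 \<le> r\<close> yields \<open>4 R \<le> \<delta> r\<close>.\<close>
    define \<delta> where "\<delta> = 4 / real R ^ 2"
    (* The recursion also involves turan_mu at r itself; its coefficient there is below 1/2. *)
    define M where "M = max (real R ^ 5) (turan_mu (r + R) r)"
    have \<delta>: "0 < \<delta>" "\<delta> \<le> 1 / 8" using R2 R8 by (auto simp: \<delta>_def field_simps)
    have "real R ^ 3 \<le> real r" using 3 by (simp flip: of_nat_power)
    then have "\<delta> * real R ^ 3 \<le> \<delta> * real r" using \<delta> by (intro mult_left_mono) auto
    moreover have "\<delta> * real R ^ 3 = 4 * real R" using R8 by (simp add: \<delta>_def eval_nat_numeral)
    ultimately have r: "4 * real R \<le> \<delta> * real r" by simp
    have "turan_mu (b + R) b \<le> M" if "b \<le> r" for b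
      using less.IH[of b] that by (cases "b = r") (auto simp: M_def)
    then have rec: "turan_mu (r + R) r
        \<le> (real R * ln (2 / \<delta>) + 3 * (1 / 2) ^ R * M) / (1 - \<delta>) ^ R"
      using turan_mu_recursion[OF _ \<delta> r] R by auto
    have M0: "0 \<le> M" by (simp add: M_def le_max_iff_disj)
    have "1 / 2 \<le> 1 - real R * \<delta>"
      using R8 by (simp add: \<delta>_def power2_eq_square field_simps)
    also have "\<dots> \<le> (1 - \<delta>) ^ R"
      using Bernoulli_inequality[of "- \<delta>" R] \<delta> by simp
    finally have half: "1 / 2 \<le> (1 - \<delta>) ^ R" .
    have "ln (2 / \<delta>) = ln (real R ^ 2 / 2)" by (simp add: \<delta>_def)
    also have "\<dots> \<le> ln (real R ^ 2)" using R8 by (intro ln_mono) auto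
    also have "\<dots> \<le> 2 * real R" using R8 ln_le_minus_one[of "real R"] by (simp add: ln_realpow)
    finally have "real R * ln (2 / \<delta>) \<le> real R * (2 * real R)"
      by (rule mult_left_mono) simp
    then have l: "real R * ln (2 / \<delta>) \<le> 2 * real R ^ 2"
      by (simp add: power2_eq_square)
    have "(1 / 2 :: real) ^ R \<le> (1 / 2) ^ 8" using R by (intro power_decreasing) auto
    moreover have "(1 / 2 :: real) ^ 8 = 1 / 256" by (simp add: power_one_over)
    ultimately have "3 * (1 / 2 :: real) ^ R \<le> 1 / 4" by linarith
    then have "3 * (1 / 2) ^ R * M \<le> 1 / 4 * M"
      using M0 by (rule mult_right_mono)
    then have "real R * ln (2 / \<delta>) + 3 * (1 / 2) ^ R * M \<le> 2 * real R ^ 2 + M / 4"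
      using l by simp
    then have "(real R * ln (2 / \<delta>) + 3 * (1 / 2) ^ R * M) / (1 - \<delta>) ^ R
        \<le> (2 * real R ^ 2 + M / 4) / (1 / 2)"
      using half M0 by (intro frac_le) auto
    then have "turan_mu (r + R) r \<le> 4 * real R ^ 2 + M / 2" using rec by simp
    \<comment> \<open>If the maximum \<open>M\<close> is \<open>turan_mu (r + R) r\<close> itself,
      half of it moves to the left side and leaves the bound 8 R^2.\<close>
    then show ?thesis using R2 R24 R4 by (auto simp: M_def max_def split: if_splits)
  qed
qed

text \<open>Shows that the error terms of \<open>turan_mu_le_log\<close> are of lower order,
  uniformly in \<open>r\<close>. For \<open>r \<ge> k ^ 2\<close>, C(r + R, R) is at least C(r + k,
  k), hence at least (r / k)^k and r^(k / 2). For smaller \<open>r\<close>, ln r is bounded while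
  C(r + R, R) is at least \<open>R\<close>.\<close>

lemma ln_le_ln_choose:
  fixes \<epsilon> :: real
  assumes "0 < \<epsilon>"
  shows "\<exists>R0. \<forall>R\<ge>R0. \<forall>r\<ge>1. 2 + 2 * ln (real r) \<le> \<epsilon> * ln (real ((r + R) choose R))"
proof -
  \<comment> \<open>With \<open>\<epsilon> k \<ge> 8\<close> the bound r^(k / 2) gives \<epsilon> ln
    C(r + R, R) \<ge> 4 ln r, which exceeds 2 + 2 ln r once ln r \<ge> 1.\<close>
  obtain k :: nat where k: "max 2 (8 / \<epsilon>) \<le> real k" using real_arch_simple by blast
  then have k2: "2 \<le> k" and k\<epsilon>: "8 \<le> \<epsilon> * real k"
    using assms by (auto simp: field_simps)
  obtain R1 :: nat where R1: "exp ((2 + 4 * ln (real k)) / \<epsilon>) \<le> real R1"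
    using real_arch_simple by blast
  have "2 + 2 * ln (real r) \<le> \<epsilon> * ln (real ((r + R) choose R))"
    if R: "max k R1 \<le> R" and r: "1 \<le> r" for r R
  proof (cases "k ^ 2 \<le> r")
    case True
    have "4 \<le> k ^ 2" using power_mono[OF k2, of 2] by simp
    then have r4: "4 \<le> real r" using True by linarith
    have "exp 1 \<le> (3 :: real)" by (rule exp_le)
    then have lr: "1 \<le> ln (real r)" using r4 by (subst ln_ge_iff) auto
    have "real k ^ 2 \<le> real r" using True by (simp flip: of_nat_power)
    then have "ln (real k ^ 2) \<le> ln (real r)" using k2 by (intro ln_mono) auto
    then have half: "2 * ln (real k) \<le> ln (real r)" using k2 by (simp add: ln_realpow)
    have "(real r / real k) ^ k \<le> (real (r + k) / real k) ^ k"
      by (intro power_mono divide_right_mono) auto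
    also have "\<dots> \<le> real (r + k choose k)"
      using binomial_ge_n_over_k_pow_k[of k "r + k", where 'a = real] by simp
    also have "r + k choose k = r + k choose r"
      using binomial_symmetric[of k "r + k"] by simp
    also have "real (r + k choose r) \<le> real (r + R choose r)"
      using binomial_right_mono[of "r + k" "r + R" r] R by simp
    also have "r + R choose r = r + R choose R"
      using binomial_symmetric[of r "r + R"] by simp
    finally have "ln ((real r / real k) ^ k) \<le> ln (real (r + R choose R))"
      using r4 k2 by (intro ln_mono) auto
    then have "real k * (ln (real r) - ln (real k)) \<le> ln (real (r + R choose R))"
      using r4 k2 by (simp add: ln_realpow ln_div)
    moreover have "real k * (ln (real r) / 2) \<le> real k * (ln (real r) - ln (real k))"
      using half by (intro mult_left_mono) auto
    ultimately have "\<epsilon> * (real k * (ln (real r) / 2)) \<le> \<epsilon> * ln (real (r + R choose R))"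
      using assms by (intro mult_left_mono) auto
    moreover have "8 * (ln (real r) / 2) \<le> (\<epsilon> * real k) * (ln (real r) / 2)"
      using k\<epsilon> lr by (intro mult_right_mono) auto
    moreover have "\<epsilon> * (real k * (ln (real r) / 2)) = (\<epsilon> * real k) * (ln (real r) / 2)"
      by simp
    ultimately show ?thesis using lr by linarith
  next
    case False
    have "real r \<le> real k ^ 2" using False by (simp flip: of_nat_power)
    then have "ln (real r) \<le> ln (real k ^ 2)" using r by (intro ln_mono) auto
    then have lr: "ln (real r) \<le> 2 * ln (real k)" using k2 by (simp add: ln_realpow)
    have "r + R \<le> r + R choose R" using R k2 r by (intro le_choose) auto
    then have "exp ((2 + 4 * ln (real k)) / \<epsilon>) \<le> real (r + R choose R)"
      using R1 R by linarith
    then have "(2 + 4 * ln (real k)) / \<epsilon> \<le> ln (real (r + R choose R))"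
      by (subst ln_ge_iff) (auto simp: zero_less_binomial)
    then have "2 + 4 * ln (real k) \<le> \<epsilon> * ln (real (r + R choose R))"
      using assms by (simp add: pos_divide_le_eq mult.commute)
    then show ?thesis using lr by simp
  qed
  then show ?thesis by blast
qed

lemma turan_mu_log_bound:
  fixes \<epsilon> :: real
  assumes "0 < \<epsilon>"
  shows "\<exists>R0. \<forall>R\<ge>R0. \<forall>r\<ge>1.
    turan_mu (r + R) r \<le> (1 + \<epsilon>) * real R * ln (real ((r + R) choose R))"
proof -
  obtain R1 where R1: "\<And>R r. R1 \<le> R \<Longrightarrow> 1 \<le> r \<Longrightarrow>
      2 + 2 * ln (real r) \<le> \<epsilon> * ln (real ((r + R) choose R))"
    using ln_le_ln_choose[OF assms] by blast
  have "turan_mu (r + R) r \<le> (1 + \<epsilon>) * real R * ln (real ((r + R) choose R))"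
    if R: "max 9 R1 \<le> R" and r: "1 \<le> r" for r R
  \<comment> \<open>\<open>turan_mu_le_log\<close> needs \<open>2 \<le> r\<close>. For
    \<open>r = 1\<close> the trivial bound \<open>R + 1\<close> is enough once ln (R + 1) \<ge> 2,
    which \<open>9 \<le> R\<close> ensures.\<close>
  proof (cases "r = 1")
    case True
    have "exp 2 = exp 1 * exp (1 :: real)" by (simp flip: exp_add)
    also have "\<dots> \<le> 3 * 3" using exp_le by (intro mult_mono) auto
    also have "\<dots> \<le> real R" using R by simp
    finally have "2 \<le> ln (real R + 1)" by (subst ln_ge_iff) auto
    then have "2 * real R \<le> ln (real R + 1) * real R" by (rule mult_right_mono) simp
    also have "\<dots> \<le> (1 + \<epsilon>) * (real R * ln (real R + 1))"
      using assms mult_right_mono[of 1 "1 + \<epsilon>" "real R * ln (real R + 1)"] by (simp add: mult.commute)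
    finally have "2 * real R \<le> (1 + \<epsilon>) * real R * ln (real R + 1)" by (simp add: mult.assoc)
    moreover have "turan_mu (r + R) r \<le> real R + 1"
      using turan_mu_le_choose[of 1 R] True by simp
    moreover have choose: "real (r + R choose R) = real R + 1"
      using binomial_symmetric[of R "Suc R"] True by simp
    ultimately show ?thesis unfolding choose using R by linarith
  next
    case False
    then have "turan_mu (r + R) r
        \<le> 2 + real R * ln (real ((r + R) choose R)) + 2 * real R * ln (real r)"
      using r R by (intro turan_mu_le_log) auto
    moreover have "real R * (2 + 2 * ln (real r)) \<le> real R * (\<epsilon> * ln (real ((r + R) choose R)))"
      using R1[of R r] R r by (intro mult_left_mono) auto
    moreover have "2 \<le> real R * 2" using R by simp
    ultimately show ?thesis by (simp add: algebra_simps)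
  qed
  then show ?thesis by blast
qed

section \<open>The exponential bound of part (ii)\<close>

lemma inverse_power_le_exp:
  fixes \<delta> :: real
  assumes "0 \<le> \<delta>" "\<delta> \<le> 1 / 8"
  shows "1 / (1 - \<delta>) ^ R \<le> exp (2 * \<delta> * real R)"
proof -
  have "\<delta> * \<delta> \<le> 1 / 8 * \<delta>" using assms by (intro mult_right_mono) auto
  then have "- (2 * \<delta>) \<le> - \<delta> - 2 * \<delta>\<^sup>2" using assms by (simp add: power2_eq_square)
  also have "\<dots> \<le> ln (1 - \<delta>)" using assms by (intro ln_one_minus_pos_lower_bound) auto
  finally have "exp (- (2 * \<delta>)) \<le> 1 - \<delta>" using assms by (subst (asm) ln_ge_iff) auto
  then have "exp (- (2 * \<delta>)) ^ R \<le> (1 - \<delta>) ^ R" by (intro power_mono) auto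
  then have "1 / (1 - \<delta>) ^ R \<le> 1 / exp (- (2 * \<delta>)) ^ R" by (intro frac_le) auto
  also have "\<dots> = exp (2 * \<delta> * real R)"
    by (simp add: exp_minus exp_of_nat_mult[symmetric] field_simps)
  finally show ?thesis .
qed

text \<open>The recursion is applied once, with \<open>M = R ^ 5\<close>. A small \<delta> keeps 1 /
  (1 - \<delta>)^R down and a large one keeps ln (2 / \<delta>) near ln R, so \<delta> is taken as
  small as \<open>4 R \<le> \<delta> r\<close> allows, but not much below 1 / R.\<close>

lemma turan_mu_exp_bound:
  fixes \<epsilon> :: real
  assumes "0 < \<epsilon>"
  shows "\<exists>R0. \<forall>R\<ge>R0. \<forall>r\<ge>1. real R \<le> sqrt (18 * real r * ln (real r)) \<longrightarrow>
    turan_mu (r + R) r \<le> exp (18 * (real R)\<^sup>2 / real r) * ((1 + \<epsilon>) * real R * ln (real R))"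
proof -
  \<comment> \<open>Small enough that the two accumulated factors 1 + 3 \<eta> and 1 + \<eta>
    multiply to at most 1 + \<epsilon>.\<close>
  define \<eta> where "\<eta> = min \<epsilon> 1 / 8"
  have \<eta>: "0 < \<eta>" "\<eta> \<le> 1 / 8" "8 * \<eta> \<le> \<epsilon>" using assms by (auto simp: \<eta>_def)
  have l1: "((\<lambda>R :: nat. 8 * real R powr (- (2 * \<eta>))) \<longlongrightarrow> 0) at_top"
    using \<eta>(1) by real_asymp
  have e1: "eventually (\<lambda>R :: nat. 8 * real R powr (- (2 * \<eta>)) < ln (1 + \<eta>)) at_top"
    using \<eta>(1) by (intro order_tendstoD(2)[OF l1]) simp
  have l2: "((\<lambda>R :: nat. 3 * (1 / 2) ^ R * real R ^ 5 / (real R * ln (real R))) \<longlongrightarrow> 0) at_top"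
    by real_asymp
  have e2: "eventually (\<lambda>R :: nat. 3 * (1 / 2) ^ R * real R ^ 5 / (real R * ln (real R)) < \<eta>) at_top"
    by (rule order_tendstoD(2)[OF l2 \<eta>(1)])
  have e3: "eventually (\<lambda>R :: nat. 576 * ln (32 * real R) < real R) at_top"
    by real_asymp
  obtain R0 where R0: "\<And>R. R0 \<le> R \<Longrightarrow> 8 * real R powr (- (2 * \<eta>)) < ln (1 + \<eta>)
      \<and> 3 * (1 / 2) ^ R * real R ^ 5 / (real R * ln (real R)) < \<eta> \<and> 576 * ln (32 * real R) < real R"
    using eventually_conj[OF e1 eventually_conj[OF e2 e3]] by (auto simp: eventually_at_top_linorder)
  have "turan_mu (r + R) r \<le> exp (18 * (real R)\<^sup>2 / real r) * ((1 + \<epsilon>) * real R * ln (real R))"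
    if R: "max 32 R0 \<le> R" and r: "1 \<le> r" and Rr: "real R \<le> sqrt (18 * real r * ln (real r))" for r R
  proof -
    have R32: "32 \<le> real R" using R by simp
    \<comment> \<open>Capping \<open>r\<close> at \<open>r1\<close> keeps 2 / \<delta> at most
      \<open>R powr (1 + 2 * \<eta>)\<close>, which costs only a factor 1 + 2 \<eta> in the
      logarithm.\<close>
    define r1 where "r1 = real R powr (2 + 2 * \<eta>)"
    define \<rho> where "\<rho> = min (real r) r1"
    define \<delta> where "\<delta> = 4 * real R / \<rho>"
    have r1_eq: "r1 = real R * real R powr (1 + 2 * \<eta>)"
      using R32 powr_mult_base[of "real R" "1 + 2 * \<eta>"] by (simp add: r1_def)
    have "real R powr 1 \<le> real R powr (1 + 2 * \<eta>)" using R32 \<eta>(1) by (intro powr_mono) auto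
    then have "32 \<le> real R powr (1 + 2 * \<eta>)" using R32 by simp
    then have "real R * 32 \<le> r1" unfolding r1_eq by (rule mult_left_mono) simp
    \<comment> \<open>Here the hypothesis \<open>R \<le> sqrt (18 r ln r)\<close> enters: a smaller
      \<open>r\<close> would force \<open>R \<le> 576 ln (32 R)\<close>, with 576 = 18 * 32, which
      is false for large \<open>R\<close>.\<close>
    moreover have "32 * real R \<le> real r"
    proof (rule ccontr)
      assume "\<not> 32 * real R \<le> real r"
      then have "18 * real r * ln (real r) \<le> 18 * (32 * real R) * ln (32 * real R)"
        using r by (intro mult_mono) auto
      moreover have "real R ^ 2 \<le> 18 * real r * ln (real r)"
        using Rr by (intro sqrt_ge_absD) simp
      ultimately have "real R * real R \<le> real R * (576 * ln (32 * real R))"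
        by (simp add: power2_eq_square mult_ac)
      then have "real R \<le> 576 * ln (32 * real R)" using R32 by (simp add: mult_le_cancel_left)
      then show False using R0[of R] R by auto
    qed
    ultimately have \<rho>: "32 * real R \<le> \<rho>" by (simp add: \<rho>_def)
    then have \<rho>0: "0 < \<rho>" using R32 by linarith
    have \<delta>: "0 < \<delta>" "\<delta> \<le> 1 / 8" using \<rho> \<rho>0 R32 by (auto simp: \<delta>_def field_simps)
    have "4 * real R = \<delta> * \<rho>" using \<rho>0 by (simp add: \<delta>_def)
    also have "\<dots> \<le> \<delta> * real r" using \<delta> by (intro mult_left_mono) (auto simp: \<rho>_def)
    finally have r4: "4 * real R \<le> \<delta> * real r" .
    have rec: "turan_mu (r + R) r
        \<le> (real R * ln (2 / \<delta>) + 3 * (1 / 2) ^ R * real R ^ 5) / (1 - \<delta>) ^ R"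
      using turan_mu_recursion[OF _ \<delta> r4 turan_mu_le_power5] R by auto
    have lnR: "0 < ln (real R)" using R32 by simp
    have "ln (2 / \<delta>) \<le> (1 + 2 * \<eta>) * ln (real R)"
    proof -
      have "2 / \<delta> = \<rho> / (2 * real R)" by (simp add: \<delta>_def)
      also have "\<dots> \<le> r1 / real R" using R32 \<rho>0 by (intro frac_le) (auto simp: \<rho>_def)
      also have "\<dots> = real R powr (1 + 2 * \<eta>)" using R32 by (simp add: r1_eq)
      finally have "ln (2 / \<delta>) \<le> ln (real R powr (1 + 2 * \<eta>))" using \<delta> by (intro ln_mono) auto
      then show ?thesis using R32 by (simp add: ln_powr)
    qed
    then have "real R * ln (2 / \<delta>) \<le> real R * ((1 + 2 * \<eta>) * ln (real R))"
      by (rule mult_left_mono) simp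
    moreover have "3 * (1 / 2) ^ R * real R ^ 5 \<le> \<eta> * (real R * ln (real R))"
      using R0[of R] R R32 lnR by (simp add: pos_divide_less_eq)
    ultimately have num: "real R * ln (2 / \<delta>) + 3 * (1 / 2) ^ R * real R ^ 5
        \<le> (1 + 3 * \<eta>) * (real R * ln (real R))"
      by (simp add: algebra_simps)
    have fac: "1 / (1 - \<delta>) ^ R \<le> exp (18 * (real R)\<^sup>2 / real r) * (1 + \<eta>)"
    proof -
      have "1 / (1 - \<delta>) ^ R \<le> exp (8 * (real R)\<^sup>2 / \<rho>)"
        using inverse_power_le_exp[of \<delta> R] \<delta> by (simp add: \<delta>_def power2_eq_square mult.assoc)
      also have "\<dots> \<le> exp (18 * (real R)\<^sup>2 / real r + ln (1 + \<eta>))"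
      \<comment> \<open>Without the cap the exponent is 8 R^2 / r, within the allowed 18 R^2 / r.
        With the cap it is 8 R^(- 2 \<eta>), which tends to 0 and is absorbed by the factor 1 +
        \<eta>.\<close>
      proof (cases "real r \<le> r1")
        case True
        have "8 * (real R)\<^sup>2 / real r \<le> 18 * (real R)\<^sup>2 / real r"
          by (intro divide_right_mono) auto
        moreover have "0 \<le> ln (1 + \<eta>)" using \<eta> by simp
        ultimately show ?thesis using True by (simp add: \<rho>_def min_def)
      next
        case False
        have "8 * (real R)\<^sup>2 / r1 = 8 * real R powr (- (2 * \<eta>))"
          using R32 by (simp add: r1_def powr_add powr_minus_divide)
        also have "\<dots> \<le> ln (1 + \<eta>)" using R0[of R] R by auto
        finally have "8 * (real R)\<^sup>2 / r1 \<le> ln (1 + \<eta>)" .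
        moreover have "0 \<le> 18 * (real R)\<^sup>2 / real r" by simp
        ultimately have "8 * (real R)\<^sup>2 / r1 \<le> 18 * (real R)\<^sup>2 / real r + ln (1 + \<eta>)"
          by linarith
        then show ?thesis using False by (simp add: \<rho>_def min_def)
      qed
      finally show ?thesis using \<eta> by (simp add: exp_add)
    qed
    have "turan_mu (r + R) r \<le> ((1 + 3 * \<eta>) * (real R * ln (real R))) * (1 / (1 - \<delta>) ^ R)"
      using order_trans[OF rec divide_right_mono[OF num]] \<delta> by simp
    also have "\<dots> \<le> ((1 + 3 * \<eta>) * (real R * ln (real R))) * (exp (18 * (real R)\<^sup>2 / real r) * (1 + \<eta>))"
      using fac \<eta> lnR by (intro mult_left_mono) auto
    also have "\<dots> = exp (18 * (real R)\<^sup>2 / real r) * (((1 + \<eta>) * (1 + 3 * \<eta>)) * (real R * ln (real R)))"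
      by (simp only: mult_ac)
    also have "\<dots> \<le> exp (18 * (real R)\<^sup>2 / real r) * ((1 + \<epsilon>) * (real R * ln (real R)))"
    proof (intro mult_left_mono mult_right_mono)
      have "\<eta> * \<eta> \<le> 1 / 8 * \<eta>" using \<eta> by (intro mult_right_mono) auto
      moreover have "(1 + \<eta>) * (1 + 3 * \<eta>) = 1 + 4 * \<eta> + 3 * (\<eta> * \<eta>)"
        by (simp add: algebra_simps)
      ultimately show "(1 + \<eta>) * (1 + 3 * \<eta>) \<le> 1 + \<epsilon>" using \<eta> by linarith
    qed (use lnR in auto)
    finally show ?thesis by (simp add: mult.assoc)
  qed
  then show ?thesis by blast
qed

theorem theorem2:
  fixes \<epsilon> :: real
  assumes "\<epsilon> > 0"
  shows "\<exists>r0 :: nat. \<forall>r R :: nat. r > 0 \<and> R > 0 \<and> R \<ge> r0 \<longrightarrow>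
    turan_mu (r + R) r \<le> (1 + \<epsilon>) * real R * ln (real ((r + R) choose R)) \<and>
    (real R \<le> sqrt (18 * real r * ln (real r)) \<longrightarrow>
      turan_mu (r + R) r \<le> exp (18 * (real R)\<^sup>2 / real r) * ((1 + \<epsilon>) * real R * ln (real R)))"
proof -
  obtain R1 where R1: "\<And>R r. R1 \<le> R \<Longrightarrow> 1 \<le> r \<Longrightarrow>
      turan_mu (r + R) r \<le> (1 + \<epsilon>) * real R * ln (real ((r + R) choose R))"
    using turan_mu_log_bound[OF assms] by blast
  obtain R2 where R2: "\<And>R r. R2 \<le> R \<Longrightarrow> 1 \<le> r \<Longrightarrow> real R \<le> sqrt (18 * real r * ln (real r)) \<Longrightarrow>
      turan_mu (r + R) r \<le> exp (18 * (real R)\<^sup>2 / real r) * ((1 + \<epsilon>) * real R * ln (real R))"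
    using turan_mu_exp_bound[OF assms] by blast
  show ?thesis
    using R1 R2 by (intro exI[of _ "max R1 R2"]) auto
qed

end
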